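(* Let $\mathbb{K}$ be a field, let $L\ge 2$ and $n_1,\dots,n_L\ge 1$ be integers, let $K^{\rightarrow}_{n_1,\ldots,n_L}$ be the fully-connected feedforward network digraph (MLP) with $L$ layers of widths $n_1,\ldots,n_L$, and let $K_{n_1,\ldots,n_L}$ be its underlying undirected graph, viewed as a simplicial complex. Then for every integer $p\ge 0$, $$\operatorname{rank}\, H_p^{\mathcal{F}}\bigl(K^{\rightarrow}_{n_1,\ldots,n_L}\bigr)=\operatorname{rank}\, H_p^{\Delta}\bigl(K_{n_1,\ldots,n_L}\bigr),$$ where $H^{\mathcal{F}}$ is directed flag complex homology, $H^{\Delta}$ is simplicial homology, and rank means dimension over $\mathbb{K}$. Specifically, this rank is $1$ for $p=0$, $1-\#V+\#E$ for $p=1$, and $0$ for $p\ge 2$, where $\#V$ and $\#E$ are the numbers of vertices and edges of the graph $K_{n_1,\ldots,n_L}$, respectively.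
   Context: The MLP digraph $K^{\rightarrow}_{n_1,\ldots,n_L}$: take pairwise disjoint finite nonempty sets (layers) $K_1,\dots,K_L$ with $|K_i|=n_i$. The vertex set is $\bigcup_{i=1}^L K_i$ and the set of directed edges is $\{(v,v') : v\in K_i,\ v'\in K_{i+1},\ 1\le i\le L-1\}$. The underlying undirected graph $K_{n_1,\ldots,n_L}$ is viewed as a simplicial complex whose $0$-simplices are the vertices and whose $1$-simplices are the edges, with no higher-dimensional simplices. $H_p^{\Delta}$ denotes its (non-reduced) simplicial homology with coefficients in $\mathbb{K}$, computed from oriented simplicial chains with boundary $\partial_p[x_0,\dots,x_p]=\sum_{i=0}^p(-1)^i[x_0,\dots,\widehat{x_i},\dots,x_p]$ for $p\ge 1$ and $\partial_0=0$. Directed flag complex (DFC) homology: for a finite digraph $G=(X,E)$ and $p\ge 0$, a directed $p$-simplex is a sequence $(x_0,\dots,x_p)$ of vertices such that $(x_i,x_j)\in E$ whenever $i<j$. $\mathcal{F}_p(G)$ is the free $\mathbb{K}$-vector space on directed $p$-simplices, with boundary $\partial_p(x_0,\dots,x_p)=\sum_{i=0}^p(-1)^i(x_0,\dots,\widehat{x_i},\dots,x_p)$ for $p\ge 1$ and $\partial_0=0$ (hat denotes omission). Then $H_p^{\mathcal{F}}(G):=\ker(\partial_p)/\operatorname{im}(\partial_{p+1})$. *)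

theory Defs
  imports
    "HOL-Algebra.QuotRing"
    "Jordan_Normal_Form.VS_Connect"
    "HOL-Library.Poly_Mapping"
    "HOL-Combinatorics.Permutations"
    "Graph_Theory.Graph_Theory"
begin

text \<open>Otherwise these would shadow the module locale and the record field of HOL-Algebra.\<close>
hide_const (open) Modules.module Multiset.mult

abbreviation vdim :: "('k::field, 'c) module \<Rightarrow> nat" where
  "vdim V \<equiv> vectorspace.dim (class_ring :: 'k ring) V"


section \<open>Quotient spaces and homology\<close>

text \<open>The quotient module of cosets, following \<^const>\<open>FactRing\<close>. Scalar multiplication takes the
  union of the cosets \<open>N + a x\<close> rather than the image of \<open>X\<close>, which would be too small for \<open>a = 0\<close>.
  The ring fields \<open>mult\<close> and \<open>one\<close> of a module record carry no meaning.\<close>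

definition quot_module :: "('k, 'c) module \<Rightarrow> 'c set \<Rightarrow> ('k, 'c set) module" where
  "quot_module M N =
    \<lparr>carrier = a_rcosets\<^bsub>M\<^esub> N, mult = undefined, one = undefined, zero = N, add = set_add M,
     smult = (\<lambda>a X. \<Union>x\<in>X. N +>\<^bsub>M\<^esub> (a \<odot>\<^bsub>M\<^esub> x))\<rparr>"

text \<open>Chain complexes are indexed by \<open>nat\<close>; \<open>d p\<close> maps \<open>C p\<close> to \<open>C (p - 1)\<close>, where truncated
  subtraction makes \<open>d 0\<close> an endomorphism of \<open>C 0\<close>. In all complexes below \<open>d 0\<close> is the zero map.\<close>

definition homology ::
  "(nat \<Rightarrow> ('k, 'c) module) \<Rightarrow> (nat \<Rightarrow> 'c \<Rightarrow> 'c) \<Rightarrow> nat \<Rightarrow> ('k, 'c set) module" where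
  "homology C d p =
    quot_module ((C p)\<lparr>carrier := {c \<in> carrier (C p). d p c = \<zero>\<^bsub>C (p - 1)\<^esub>}\<rparr>)
      (d (Suc p) ` carrier (C (Suc p)))"


section \<open>Chains on vertex sequences\<close>

definition free_module :: "'a set \<Rightarrow> ('k::field, 'a \<Rightarrow>\<^sub>0 'k) module" where
  "free_module S =
    \<lparr>carrier = {c. Poly_Mapping.keys c \<subseteq> S}, mult = undefined, one = undefined, zero = 0, add = (+),
     smult = (\<lambda>a. Poly_Mapping.map ((*) a))\<rparr>"

definition omit_nth :: "nat \<Rightarrow> 'a list \<Rightarrow> 'a list" where
  "omit_nth i xs = take i xs @ drop (Suc i) xs"

definition boundary :: "nat \<Rightarrow> ('v list \<Rightarrow>\<^sub>0 'k::field) \<Rightarrow> ('v list \<Rightarrow>\<^sub>0 'k)" where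
  "boundary p c =
    (if p = 0 then 0
     else \<Sum>x\<in>Poly_Mapping.keys c. \<Sum>i\<le>p.
       Poly_Mapping.single (omit_nth i x) ((-1) ^ i * Poly_Mapping.lookup c x))"


section \<open>Directed flag complex homology\<close>

definition directed_simplices :: "'v pair_pre_digraph \<Rightarrow> nat \<Rightarrow> 'v list set" where
  "directed_simplices G p =
    {xs. length xs = Suc p \<and> set xs \<subseteq> pverts G \<and>
         (\<forall>i j. i < j \<and> j < length xs \<longrightarrow> (xs ! i, xs ! j) \<in> parcs G)}"

definition dfc_homology ::
  "'v pair_pre_digraph \<Rightarrow> nat \<Rightarrow> ('k::field, ('v list \<Rightarrow>\<^sub>0 'k) set) module" where
  "dfc_homology G = homology (\<lambda>p. free_module (directed_simplices G p)) boundary"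


section \<open>Simplicial homology via oriented chains\<close>

text \<open>A simplicial complex is given by its set of nonempty simplices. An oriented simplex
  \<open>[x\<^sub>0, \<dots>, x\<^sub>p]\<close> is the class of an ordering of the vertices of a simplex modulo
  \<open>[x\<^sub>\<sigma>\<^sub>0, \<dots>, x\<^sub>\<sigma>\<^sub>p] = sgn \<sigma> [x\<^sub>0, \<dots>, x\<^sub>p]\<close>.\<close>

definition ordered_simplices :: "'v set set \<Rightarrow> nat \<Rightarrow> 'v list set" where
  "ordered_simplices \<Delta> p = {xs. length xs = Suc p \<and> distinct xs \<and> set xs \<in> \<Delta>}"

definition orientation_relations :: "'v set set \<Rightarrow> nat \<Rightarrow> ('v list \<Rightarrow>\<^sub>0 'k::field) set" where
  "orientation_relations \<Delta> p =
    LinearCombinations.module.span class_ring (free_module (ordered_simplices \<Delta> p))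
      {Poly_Mapping.single (permute_list \<sigma> x) 1 - Poly_Mapping.single x (of_int (sign \<sigma>)) | \<sigma> x.
        \<sigma> permutes {..<length x} \<and> x \<in> ordered_simplices \<Delta> p}"

definition oriented_chains ::
  "'v set set \<Rightarrow> nat \<Rightarrow> ('k::field, ('v list \<Rightarrow>\<^sub>0 'k) set) module" where
  "oriented_chains \<Delta> p =
    quot_module (free_module (ordered_simplices \<Delta> p)) (orientation_relations \<Delta> p)"

text \<open>The map on classes induced by \<^const>\<open>boundary\<close>, so that
  \<open>\<partial>[x\<^sub>0, \<dots>, x\<^sub>p] = \<Sum>i\<le>p. (-1)^i [x\<^sub>0, \<dots>, x\<^sub>i\<^sub>-\<^sub>1, x\<^sub>i\<^sub>+\<^sub>1, \<dots>, x\<^sub>p]\<close> for \<open>p > 0\<close>.\<close>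

definition oriented_boundary ::
  "'v set set \<Rightarrow> nat \<Rightarrow> ('v list \<Rightarrow>\<^sub>0 'k::field) set \<Rightarrow> ('v list \<Rightarrow>\<^sub>0 'k) set" where
  "oriented_boundary \<Delta> p X =
    (\<Union>c\<in>X. orientation_relations \<Delta> (p - 1)
       +>\<^bsub>free_module (ordered_simplices \<Delta> (p - 1))\<^esub> boundary p c)"

definition simplicial_homology ::
  "'v set set \<Rightarrow> nat \<Rightarrow> ('k::field, ('v list \<Rightarrow>\<^sub>0 'k) set set) module" where
  "simplicial_homology \<Delta> = homology (oriented_chains \<Delta>) (oriented_boundary \<Delta>)"


section \<open>Feedforward networks\<close>

text \<open>The layers are \<open>K 1, \<dots>, K L\<close>; values of \<open>K\<close> at other indices are ignored.\<close>

definition mlp_layers :: "nat \<Rightarrow> (nat \<Rightarrow> nat) \<Rightarrow> (nat \<Rightarrow> 'v set) \<Rightarrow> bool" where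
  "mlp_layers L n K \<longleftrightarrow>
    disjoint_family_on K {1..L} \<and> (\<forall>i\<in>{1..L}. finite (K i) \<and> card (K i) = n i)"

definition mlp_digraph :: "nat \<Rightarrow> (nat \<Rightarrow> 'v set) \<Rightarrow> 'v pair_pre_digraph" where
  "mlp_digraph L K =
    \<lparr>pverts = (\<Union>i\<in>{1..L}. K i), parcs = (\<Union>i\<in>{1..L - 1}. K i \<times> K (i + 1))\<rparr>"

definition undirected_edges :: "'v pair_pre_digraph \<Rightarrow> 'v set set" where
  "undirected_edges G = {{u, v} | u v. (u, v) \<in> parcs G}"

definition underlying_complex :: "'v pair_pre_digraph \<Rightarrow> 'v set set" where
  "underlying_complex G = {{v} | v. v \<in> pverts G} \<union> undirected_edges G"

end

theory Submission
  imports Defs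
begin

text \<open>Layers are pairwise disjoint and arcs only join a layer to the next one, so two composable arcs
  \<open>u \<rightarrow> v \<rightarrow> w\<close> never admit the shortcut \<open>u \<rightarrow> w\<close>. Hence the directed flag complex of the network has only
  vertices and arcs as simplices, exactly like the underlying graph, and both homologies are those of
  a connected one-dimensional complex. The argument is carried out for finite asymmetric digraphs
  without such transitive triples (locale \<open>flat_digraph\<close>) that are weakly connected; the network is
  one by \<open>flat_digraph_mlp\<close> and \<open>mlp_connected\<close>.

  The ranks of directed flag complex homology (\<open>vdim_dfc_homology\<close>) come from rank-nullity.
  The image of \<open>\<partial>\<^sub>1\<close> consists of the \<open>0\<close>-chains whose coefficients sum to \<open>0\<close>, because in a weakly
  connected digraph the difference of any two vertices is the boundary of a path between them. So
  \<open>\<partial>\<^sub>1\<close> has rank \<open>#V - 1\<close>, which leaves \<open>1\<close> for \<open>H\<^sub>0\<close>, \<open>#E - (#V - 1)\<close> for the kernel of \<open>\<partial>\<^sub>1\<close>, which is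
  \<open>H\<^sub>1\<close> up to a quotient by \<open>0\<close>, and nothing in higher degrees.

  The comparison with simplicial homology (\<open>vdim_simplicial_homology_eq_dfc\<close>) is an isomorphism of
  chain complexes in the sense of \<open>vdim_homology_chain_iso\<close>: it sends a directed simplex to its
  oriented class. An edge of the graph carries exactly one of its two orders as an arc, by asymmetry,
  so replacing every ordered edge by plus or minus the arc that it contains defines a retraction
  \<open>straighten\<close> of ordered chains onto directed chains. It kills the orientation relations, and a
  chain differs from its straightening by such relations; this gives injectivity and surjectivity.\<close>

section \<open>Linear maps, dimension and quotients of vector spaces\<close>

lemma linear_mapI:
  fixes V :: "('k::field, 'a) module" and W :: "('k, 'b) module"
  assumes "vectorspace (class_ring :: 'k ring) V" "vectorspace (class_ring :: 'k ring) W"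
    and "\<And>v. v \<in> carrier V \<Longrightarrow> f v \<in> carrier W"
    and "\<And>v w. v \<in> carrier V \<Longrightarrow> w \<in> carrier V \<Longrightarrow> f (v \<oplus>\<^bsub>V\<^esub> w) = f v \<oplus>\<^bsub>W\<^esub> f w"
    and "\<And>a v. v \<in> carrier V \<Longrightarrow> f (a \<odot>\<^bsub>V\<^esub> v) = a \<odot>\<^bsub>W\<^esub> f v"
  shows "linear_map (class_ring :: 'k ring) V W f"
  unfolding linear_map_def mod_hom_def mod_hom_axioms_def LinearCombinations.module_hom_def
  using assms by (auto simp: vectorspace_def)

text \<open>Every vector space axiom is an identity or an existence statement about operations that \<open>f\<close>
  respects, so it passes to the image. This makes quotients vector spaces without redoing the
  axioms on cosets.\<close>
lemma vectorspace_surj_image: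
  fixes V :: "('k::field, 'a) module" and W :: "('k, 'b) module"
  assumes V: "vectorspace (class_ring :: 'k ring) V"
    and surj: "f ` carrier V = carrier W"
    and add: "\<And>v w. v \<in> carrier V \<Longrightarrow> w \<in> carrier V \<Longrightarrow> f (v \<oplus>\<^bsub>V\<^esub> w) = f v \<oplus>\<^bsub>W\<^esub> f w"
    and smult: "\<And>a v. v \<in> carrier V \<Longrightarrow> f (a \<odot>\<^bsub>V\<^esub> v) = a \<odot>\<^bsub>W\<^esub> f v"
    and zero: "f \<zero>\<^bsub>V\<^esub> = \<zero>\<^bsub>W\<^esub>"
  shows "vectorspace (class_ring :: 'k ring) W"
proof -
  interpret V: vectorspace "class_ring :: 'k ring" V by fact
  have lift: "(\<forall>w\<in>carrier W. P w) \<longleftrightarrow> (\<forall>v\<in>carrier V. P (f v))" for P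
    unfolding surj[symmetric] by blast
  have scal: "a \<odot>\<^bsub>V\<^esub> v \<in> carrier V" if "v \<in> carrier V" for a v
    using that V.smult_closed[of a v] by simp
  have cl: "f v \<in> carrier W" if "v \<in> carrier V" for v using that surj by blast
  show ?thesis
  proof (rule vs_criteria)
    show "field (class_ring :: 'k ring)" by (rule class_field)
    show "\<zero>\<^bsub>W\<^esub> \<in> carrier W" using zero surj V.zero_closed by force
    have "\<forall>v\<in>carrier W. \<forall>w\<in>carrier W. v \<oplus>\<^bsub>W\<^esub> w \<in> carrier W"
      unfolding lift by (auto simp: add[symmetric] intro!: cl)
    then show "\<forall>v w. v \<in> carrier W \<and> w \<in> carrier W \<longrightarrow> v \<oplus>\<^bsub>W\<^esub> w \<in> carrier W" by blast
    show "\<forall>v\<in>carrier W. \<exists>u\<in>carrier W. v \<oplus>\<^bsub>W\<^esub> u = \<zero>\<^bsub>W\<^esub>"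
      unfolding lift
    proof
      fix v assume v: "v \<in> carrier V"
      have "f v \<oplus>\<^bsub>W\<^esub> f (\<ominus>\<^bsub>V\<^esub> v) = \<zero>\<^bsub>W\<^esub>"
        using v by (simp add: add[symmetric] V.r_neg zero)
      then show "\<exists>u\<in>carrier W. f v \<oplus>\<^bsub>W\<^esub> u = \<zero>\<^bsub>W\<^esub>"
        using v by (intro bexI[of _ "f (\<ominus>\<^bsub>V\<^esub> v)"]) (auto intro: cl)
    qed
    have "\<forall>v\<in>carrier W. \<forall>c. c \<odot>\<^bsub>W\<^esub> v \<in> carrier W"
      unfolding lift by (auto simp: smult[symmetric] intro!: cl scal)
    then show "\<forall>c v. c \<in> carrier class_ring \<and> v \<in> carrier W \<longrightarrow> c \<odot>\<^bsub>W\<^esub> v \<in> carrier W" by blast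
    have "\<forall>v\<in>carrier W. \<forall>w\<in>carrier W. v \<oplus>\<^bsub>W\<^esub> w = w \<oplus>\<^bsub>W\<^esub> v"
      unfolding lift by (auto simp: add[symmetric] V.a_comm)
    then show "\<forall>v w. v \<in> carrier W \<and> w \<in> carrier W \<longrightarrow> v \<oplus>\<^bsub>W\<^esub> w = w \<oplus>\<^bsub>W\<^esub> v" by blast
    have "\<forall>v\<in>carrier W. \<forall>w\<in>carrier W. \<forall>x\<in>carrier W. v \<oplus>\<^bsub>W\<^esub> w \<oplus>\<^bsub>W\<^esub> x = v \<oplus>\<^bsub>W\<^esub> (w \<oplus>\<^bsub>W\<^esub> x)"
      unfolding lift by (auto simp: add[symmetric] V.a_assoc)
    then show "\<forall>v w x. v \<in> carrier W \<and> w \<in> carrier W \<and> x \<in> carrier W \<longrightarrow>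
        v \<oplus>\<^bsub>W\<^esub> w \<oplus>\<^bsub>W\<^esub> x = v \<oplus>\<^bsub>W\<^esub> (w \<oplus>\<^bsub>W\<^esub> x)" by blast
    show "\<forall>v\<in>carrier W. v \<oplus>\<^bsub>W\<^esub> \<zero>\<^bsub>W\<^esub> = v"
      unfolding lift by (auto simp: zero[symmetric] add[symmetric])
    have "\<forall>v\<in>carrier W. \<forall>a b. (a * b) \<odot>\<^bsub>W\<^esub> v = a \<odot>\<^bsub>W\<^esub> (b \<odot>\<^bsub>W\<^esub> v)"
      unfolding lift using V.smult_assoc1 by (auto simp: smult[symmetric] scal)
    then show "\<forall>a b v. a \<in> carrier class_ring \<and> b \<in> carrier class_ring \<and> v \<in> carrier W \<longrightarrow>
        (a \<otimes>\<^bsub>class_ring\<^esub> b) \<odot>\<^bsub>W\<^esub> v = a \<odot>\<^bsub>W\<^esub> (b \<odot>\<^bsub>W\<^esub> v)" by simp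
    show "\<forall>v\<in>carrier W. \<one>\<^bsub>class_ring\<^esub> \<odot>\<^bsub>W\<^esub> v = v"
      unfolding lift using V.smult_one by (auto simp: smult[symmetric])
    have "\<forall>v\<in>carrier W. \<forall>a b. (a + b) \<odot>\<^bsub>W\<^esub> v = a \<odot>\<^bsub>W\<^esub> v \<oplus>\<^bsub>W\<^esub> b \<odot>\<^bsub>W\<^esub> v"
      unfolding lift using V.smult_l_distr by (auto simp: smult[symmetric] add[symmetric] scal)
    then show "\<forall>a b v. a \<in> carrier class_ring \<and> b \<in> carrier class_ring \<and> v \<in> carrier W \<longrightarrow>
        (a \<oplus>\<^bsub>class_ring\<^esub> b) \<odot>\<^bsub>W\<^esub> v = a \<odot>\<^bsub>W\<^esub> v \<oplus>\<^bsub>W\<^esub> b \<odot>\<^bsub>W\<^esub> v" by simp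
    have "\<forall>v\<in>carrier W. \<forall>w\<in>carrier W. \<forall>a. a \<odot>\<^bsub>W\<^esub> (v \<oplus>\<^bsub>W\<^esub> w) = a \<odot>\<^bsub>W\<^esub> v \<oplus>\<^bsub>W\<^esub> a \<odot>\<^bsub>W\<^esub> w"
      unfolding lift using V.smult_r_distr by (auto simp: smult[symmetric] add[symmetric] scal)
    then show "\<forall>a v w. a \<in> carrier class_ring \<and> v \<in> carrier W \<and> w \<in> carrier W \<longrightarrow>
        a \<odot>\<^bsub>W\<^esub> (v \<oplus>\<^bsub>W\<^esub> w) = a \<odot>\<^bsub>W\<^esub> v \<oplus>\<^bsub>W\<^esub> a \<odot>\<^bsub>W\<^esub> w" by blast
  qed
qed

text \<open>Independent subsets of \<open>N\<close> are independent in \<open>V\<close>, so their size is bounded by \<open>dim V\<close>, and a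
  maximal one is a finite basis of \<open>N\<close>.\<close>
lemma fin_dim_subspace:
  assumes "vectorspace K V" "VectorSpace.subspace K N V" "vectorspace.fin_dim K V"
  shows "vectorspace.fin_dim K (V\<lparr>carrier := N\<rparr>)"
proof -
  interpret V: vectorspace K V by fact
  have sub: "submodule K N V" using assms(2) by (simp add: VectorSpace.subspace_def)
  interpret N: vectorspace K "V\<lparr>carrier := N\<rparr>" by (rule V.subspace_is_vs[OF assms(2)])
  have "N \<subseteq> carrier V" using sub by (simp add: submodule_def)
  then have small: "finite A \<and> card A \<le> V.dim" if "A \<subseteq> carrier (V\<lparr>carrier := N\<rparr>) \<and> N.lin_indpt A" for A
    using that V.span_li_not_depend(2)[OF _ sub, of A] V.li_le_dim[OF assms(3), of A] by auto
  have "\<exists>A. finite A \<and> maximal A (\<lambda>A. A \<subseteq> carrier (V\<lparr>carrier := N\<rparr>) \<and> N.lin_indpt A)"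
  proof (rule maximal_exists)
    show "finite A \<and> card A \<le> V.dim" if "A \<subseteq> carrier (V\<lparr>carrier := N\<rparr>) \<and> N.lin_indpt A" for A
      using small[OF that] .
    show "{} \<subseteq> carrier (V\<lparr>carrier := N\<rparr>) \<and> N.lin_indpt {}"
      by (simp add: N.lin_dep_def)
  qed
  then obtain A where "finite A" "N.basis A" using N.max_li_is_basis by blast
  then show ?thesis unfolding N.fin_dim_def N.basis_def by blast
qed

lemma fin_dim_surj_image:
  assumes "linear_map K V W f" "f ` carrier V = carrier W" "vectorspace.fin_dim K V"
  shows "vectorspace.fin_dim K W"
  using linear_map.rank_nullity_main(2)[OF assms(1,3,2)] .

lemma rank_nullity_surj:
  assumes "linear_map K V W f" "f ` carrier V = carrier W" "vectorspace.fin_dim K V"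
  shows "vectorspace.dim K W + vectorspace.dim K (V\<lparr>carrier := {v \<in> carrier V. f v = \<zero>\<^bsub>W\<^esub>}\<rparr>) =
    vectorspace.dim K V"
proof -
  interpret linear_map K V W f by fact
  show ?thesis using rank_nullity[OF assms(3)] assms(2) by (simp add: im_def ker_def)
qed

lemma subspace_image:
  assumes "linear_map K V W f" "VectorSpace.subspace K N V"
  shows "VectorSpace.subspace K (f ` N) W"
proof -
  interpret linear_map K V W f by fact
  have *: "submodule K N V" using assms(2) by (simp add: VectorSpace.subspace_def)
  have N: "N \<subseteq> carrier V" using * by (simp add: submodule_def)
  have "submodule K (f ` N) W"
  proof
    show "f ` N \<subseteq> carrier W" using N by auto
    show "\<zero>\<^bsub>W\<^esub> \<in> f ` N" using * f0_is_0 by (metis image_eqI submodule.zero_closed)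
    show "v \<oplus>\<^bsub>W\<^esub> w \<in> f ` N" if vw: "v \<in> f ` N" "w \<in> f ` N" for v w
    proof -
      obtain x y where "x \<in> N" "y \<in> N" "v = f x" "w = f y" using vw by blast
      then have "v \<oplus>\<^bsub>W\<^esub> w = f (x \<oplus>\<^bsub>V\<^esub> y)" using N by (simp add: subsetD)
      with \<open>x \<in> N\<close> \<open>y \<in> N\<close> show ?thesis using submodule.m_closed[OF *] by blast
    qed
    show "c \<odot>\<^bsub>W\<^esub> v \<in> f ` N" if cv: "c \<in> carrier K" "v \<in> f ` N" for c v
    proof -
      obtain x where "x \<in> N" "v = f x" using cv by blast
      then have "c \<odot>\<^bsub>W\<^esub> v = f (c \<odot>\<^bsub>V\<^esub> x)" using N cv by (simp add: subsetD)
      with \<open>x \<in> N\<close> show ?thesis using submodule.smult_closed[OF * cv(1)] by blast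
    qed
  qed
  then show ?thesis by (simp add: VectorSpace.subspace_def W.vectorspace_axioms)
qed

lemma dim_image_inj:
  fixes V :: "('k::field, 'a) module" and W :: "('k, 'b) module"
  assumes lin: "linear_map (class_ring :: 'k ring) V W f" and sub: "VectorSpace.subspace class_ring N V" and inj: "inj_on f N"
    and finV: "vectorspace.fin_dim (class_ring :: 'k ring) V"
  shows "vdim (W\<lparr>carrier := f ` N\<rparr>) = vdim (V\<lparr>carrier := N\<rparr>)"
proof -
  interpret linear_map "class_ring :: 'k ring" V W f by fact
  have N: "N \<subseteq> carrier V" using sub by (simp add: submodule_def VectorSpace.subspace_def)
  have "linear_map class_ring (V\<lparr>carrier := N\<rparr>) (W\<lparr>carrier := f ` N\<rparr>) f"
    using N f_smult
    by (intro linear_mapI V.subspace_is_vs sub W.subspace_is_vs subspace_image[OF lin sub]) (auto simp: subsetD)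
  from linear_map.dim_eq[OF this fin_dim_subspace[OF V.vectorspace_axioms sub finV]] inj
  show ?thesis by simp
qed

section \<open>Quotient spaces and the dimension of homology\<close>

text \<open>The scalar action on a coset is a union of cosets over all its elements; the point is that these
  cosets coincide, so that the projection is linear.\<close>
lemma
  fixes V :: "('k::field, 'a) module"
  assumes V: "vectorspace (class_ring :: 'k ring) V" and sub: "VectorSpace.subspace class_ring N V"
  shows vectorspace_quot_module: "vectorspace (class_ring :: 'k ring) (quot_module V N)"
    and linear_map_coset: "linear_map (class_ring :: 'k ring) V (quot_module V N) (\<lambda>v. N +>\<^bsub>V\<^esub> v)"
    and coset_surj: "(\<lambda>v. N +>\<^bsub>V\<^esub> v) ` carrier V = carrier (quot_module V N)"
    and coset_eq_iff: "\<And>v w. v \<in> carrier V \<Longrightarrow> w \<in> carrier V \<Longrightarrow>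
      N +>\<^bsub>V\<^esub> v = N +>\<^bsub>V\<^esub> w \<longleftrightarrow> v \<ominus>\<^bsub>V\<^esub> w \<in> N"
proof -
  interpret V: vectorspace "class_ring :: 'k ring" V by fact
  have sm: "submodule class_ring N V" using sub by (simp add: VectorSpace.subspace_def)
  have N: "N \<subseteq> carrier V" using sm by (simp add: submodule_def)
  have scal: "a \<odot>\<^bsub>V\<^esub> v \<in> carrier V" if "v \<in> carrier V" for a v
    using that V.smult_closed[of a v] by simp
  have neg: "\<ominus>\<^bsub>V\<^esub> v \<in> N" if "v \<in> N" for v
    using submodule.smult_closed[OF sm, of "- 1" v] V.smult_minus_1[of v] that N by (auto simp: class_ring_simps)
  interpret abelian_subgroup N V
  proof (rule abelian_subgroupI2)
    show "comm_group (add_monoid V)" by (rule V.a_comm_group)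
    show "subgroup N (add_monoid V)"
      using N neg submodule.m_closed[OF sm] submodule.zero_closed[OF sm]
      by (intro subgroup.intro) (auto simp flip: a_inv_def)
  qed
  show eq_iff: "N +>\<^bsub>V\<^esub> v = N +>\<^bsub>V\<^esub> w \<longleftrightarrow> v \<ominus>\<^bsub>V\<^esub> w \<in> N" if "v \<in> carrier V" "w \<in> carrier V" for v w
    using that a_rcos_module a_repr_independence' a_rcos_self by (metis a_minus_def)
  show surj: "(\<lambda>v. N +>\<^bsub>V\<^esub> v) ` carrier V = carrier (quot_module V N)"
    by (auto simp: quot_module_def A_RCOSETS_def')
  have add: "N +>\<^bsub>V\<^esub> (v \<oplus>\<^bsub>V\<^esub> w) = (N +>\<^bsub>V\<^esub> v) \<oplus>\<^bsub>quot_module V N\<^esub> (N +>\<^bsub>V\<^esub> w)"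
    if "v \<in> carrier V" "w \<in> carrier V" for v w
    using that by (simp add: quot_module_def a_rcos_sum)
  have smult: "N +>\<^bsub>V\<^esub> (a \<odot>\<^bsub>V\<^esub> v) = a \<odot>\<^bsub>quot_module V N\<^esub> (N +>\<^bsub>V\<^esub> v)" if v: "v \<in> carrier V" for a v
  proof -
    have "N +>\<^bsub>V\<^esub> (a \<odot>\<^bsub>V\<^esub> w) = N +>\<^bsub>V\<^esub> (a \<odot>\<^bsub>V\<^esub> v)" if w: "w \<in> N +>\<^bsub>V\<^esub> v" for w
    proof -
      have wV: "w \<in> carrier V" using w v N V.a_r_coset_subset_G by blast
      have "w \<ominus>\<^bsub>V\<^esub> v \<in> N" using w v wV a_rcos_module by (simp add: a_minus_def)
      then have "a \<odot>\<^bsub>V\<^esub> (w \<ominus>\<^bsub>V\<^esub> v) \<in> N" using submodule.smult_closed[OF sm, of a] by simp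
      moreover have "a \<odot>\<^bsub>V\<^esub> (w \<ominus>\<^bsub>V\<^esub> v) = a \<odot>\<^bsub>V\<^esub> w \<ominus>\<^bsub>V\<^esub> a \<odot>\<^bsub>V\<^esub> v"
        using V.smult_r_distr[of a w "\<ominus>\<^bsub>V\<^esub> v"] V.smult_r_minus[of a v] v wV by (simp add: a_minus_def)
      ultimately show ?thesis using eq_iff v wV scal by simp
    qed
    then have "(\<Union>w\<in>N +>\<^bsub>V\<^esub> v. N +>\<^bsub>V\<^esub> (a \<odot>\<^bsub>V\<^esub> w)) = (\<Union>w\<in>N +>\<^bsub>V\<^esub> v. N +>\<^bsub>V\<^esub> (a \<odot>\<^bsub>V\<^esub> v))"
      by (intro SUP_cong refl)
    then show ?thesis using a_rcos_self[OF v] by (auto simp: quot_module_def)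
  qed
  show vs: "vectorspace (class_ring :: 'k ring) (quot_module V N)"
    by (rule vectorspace_surj_image[OF V surj add smult])
      (simp_all add: quot_module_def N V.a_coset_add_zero)
  show "linear_map (class_ring :: 'k ring) V (quot_module V N) (\<lambda>v. N +>\<^bsub>V\<^esub> v)"
    by (rule linear_mapI[OF V vs]) (use surj add smult in auto)
qed

lemma vdim_quot_module:
  fixes V :: "('k::field, 'a) module"
  assumes V: "vectorspace (class_ring :: 'k ring) V" and sub: "VectorSpace.subspace class_ring N V"
    and finV: "vectorspace.fin_dim (class_ring :: 'k ring) V"
  shows "vdim (quot_module V N) + vdim (V\<lparr>carrier := N\<rparr>) = vdim V"
proof -
  interpret V: vectorspace "class_ring :: 'k ring" V by fact
  have N: "N \<subseteq> carrier V" using sub by (simp add: submodule_def VectorSpace.subspace_def)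
  have "N +>\<^bsub>V\<^esub> v = N \<longleftrightarrow> v \<in> N" if "v \<in> carrier V" for v
    using coset_eq_iff[OF V sub that V.zero_closed] V.a_coset_add_zero[OF N] that
    by (simp add: a_minus_def V.add.inv_one[folded a_inv_def])
  then have "{v \<in> carrier V. N +>\<^bsub>V\<^esub> v = \<zero>\<^bsub>quot_module V N\<^esub>} = N"
    using N by (auto simp: quot_module_def)
  then show ?thesis
    using rank_nullity_surj[OF linear_map_coset[OF V sub] coset_surj[OF V sub] finV] by simp
qed

lemma vdim_quot_subspaces:
  fixes V :: "('k::field, 'a) module"
  assumes V: "vectorspace (class_ring :: 'k ring) V" and finV: "vectorspace.fin_dim (class_ring :: 'k ring) V"
    and X: "VectorSpace.subspace class_ring X V" and Y: "VectorSpace.subspace class_ring Y V" and YX: "Y \<subseteq> X"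
  shows "vdim (quot_module (V\<lparr>carrier := X\<rparr>) Y) + vdim (V\<lparr>carrier := Y\<rparr>) = vdim (V\<lparr>carrier := X\<rparr>)"
proof -
  have X': "vectorspace (class_ring :: 'k ring) (V\<lparr>carrier := X\<rparr>)"
    by (rule vectorspace.subspace_is_vs[OF V X])
  moreover have "VectorSpace.subspace class_ring Y (V\<lparr>carrier := X\<rparr>)"
    using Y YX X' unfolding VectorSpace.subspace_def submodule_def by (auto simp: vectorspace_def)
  ultimately show ?thesis
    using vdim_quot_module[OF X' _ fin_dim_subspace[OF V X finV]] by fastforce
qed

text \<open>Together with \<open>rank_nullity_vdim\<close> this determines the dimension of the homology from the dimensions
  of the chain spaces and the ranks of the boundary maps. It is stated as a sum because subtraction of naturals truncates.\<close>
lemma vdim_homology: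
  fixes C :: "nat \<Rightarrow> ('k::field, 'a) module"
  assumes C: "\<And>p. vectorspace (class_ring :: 'k ring) (C p)"
    and fin: "\<And>p. vectorspace.fin_dim (class_ring :: 'k ring) (C p)"
    and d: "\<And>p. linear_map (class_ring :: 'k ring) (C p) (C (p - 1)) (d p)"
    and dd: "\<And>c. c \<in> carrier (C (Suc p)) \<Longrightarrow> d p (d (Suc p) c) = \<zero>\<^bsub>C (p - 1)\<^esub>"
  shows "vdim (homology C d p) + vdim ((C p)\<lparr>carrier := d (Suc p) ` carrier (C (Suc p))\<rparr>) =
    vdim ((C p)\<lparr>carrier := {c \<in> carrier (C p). d p c = \<zero>\<^bsub>C (p - 1)\<^esub>}\<rparr>)"
proof -
  interpret d: linear_map "class_ring :: 'k ring" "C p" "C (p - 1)" "d p" by (rule d)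
  interpret d': linear_map "class_ring :: 'k ring" "C (Suc p)" "C p" "d (Suc p)" using d[of "Suc p"] by simp
  show ?thesis
    unfolding homology_def d.ker_def[symmetric] d'.im_def[symmetric]
    by (rule vdim_quot_subspaces[OF C fin d.kerT_is_subspace d'.imT_is_subspace])
      (auto simp: d.ker_def d'.im_def dd simp del: One_nat_def)
qed

lemma rank_nullity_vdim:
  fixes V :: "('k::field, 'a) module" and W :: "('k, 'b) module"
  assumes "linear_map (class_ring :: 'k ring) V W f" "vectorspace.fin_dim (class_ring :: 'k ring) V"
  shows "vdim (W\<lparr>carrier := f ` carrier V\<rparr>) + vdim (V\<lparr>carrier := {v \<in> carrier V. f v = \<zero>\<^bsub>W\<^esub>}\<rparr>) = vdim V"
  using linear_map.rank_nullity[OF assms]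
    mod_hom.im_def[of "class_ring :: 'k ring" V W f] mod_hom.ker_def[of "class_ring :: 'k ring" V W f] assms(1)
  by (simp add: linear_map_def)

text \<open>The map \<open>g p\<close> carries cycles onto cycles and boundaries onto boundaries, injectively, so the two
  subspaces whose dimensions differ by that of the homology have the same dimensions on both sides.\<close>
lemma vdim_homology_chain_iso:
  fixes C :: "nat \<Rightarrow> ('k::field, 'a) module" and D :: "nat \<Rightarrow> ('k, 'b) module"
  assumes C: "\<And>p. vectorspace (class_ring :: 'k ring) (C p)"
    and fin: "\<And>p. vectorspace.fin_dim (class_ring :: 'k ring) (C p)"
    and d: "\<And>p. linear_map (class_ring :: 'k ring) (C p) (C (p - 1)) (d p)"
    and dd: "\<And>c. c \<in> carrier (C (Suc p)) \<Longrightarrow> d p (d (Suc p) c) = \<zero>\<^bsub>C (p - 1)\<^esub>"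
    and g: "\<And>p. linear_map (class_ring :: 'k ring) (C p) (D p) (g p)"
    and bij: "\<And>p. bij_betw (g p) (carrier (C p)) (carrier (D p))"
    and comm: "\<And>p c. c \<in> carrier (C p) \<Longrightarrow> e p (g p c) = g (p - 1) (d p c)"
  shows "vdim (homology D e p) = vdim (homology C d p)"
proof -
  define Z where "Z = {c \<in> carrier (C p). d p c = \<zero>\<^bsub>C (p - 1)\<^esub>}"
  define B where "B = d (Suc p) ` carrier (C (Suc p))"
  interpret C': vectorspace "class_ring :: 'k ring" "C (p - 1)" by (rule C)
  interpret d: linear_map "class_ring :: 'k ring" "C p" "C (p - 1)" "d p" by (rule d)
  interpret d': linear_map "class_ring :: 'k ring" "C (Suc p)" "C p" "d (Suc p)" using d[of "Suc p"] by simp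
  interpret g: linear_map "class_ring :: 'k ring" "C p" "D p" "g p" by (rule g)
  interpret g': linear_map "class_ring :: 'k ring" "C (p - 1)" "D (p - 1)" "g (p - 1)" by (rule g)
  have Z: "VectorSpace.subspace class_ring Z (C p)"
    using d.kerT_is_subspace unfolding Z_def d.ker_def .
  have B: "VectorSpace.subspace class_ring B (C p)"
    using d'.imT_is_subspace unfolding B_def d'.im_def .
  have BZ: "B \<subseteq> Z" by (auto simp: B_def Z_def dd)
  have ZC: "Z \<subseteq> carrier (C p)" by (auto simp: Z_def)
  have inj: "inj_on (g q) (carrier (C q))" and surj: "carrier (D q) = g q ` carrier (C q)" for q
    using bij[of q] by (auto simp: bij_betw_def)
  have "e p (g p c) = \<zero>\<^bsub>D (p - 1)\<^esub> \<longleftrightarrow> d p c = \<zero>\<^bsub>C (p - 1)\<^esub>" if "c \<in> carrier (C p)" for c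
    unfolding comm[OF that] g'.f0_is_0[symmetric]
    by (rule inj_on_eq_iff[OF inj d.f_im[OF that] C'.zero_closed])
  then have ZD: "{x \<in> carrier (D p). e p x = \<zero>\<^bsub>D (p - 1)\<^esub>} = g p ` Z"
    unfolding surj Z_def by auto
  have BD: "e (Suc p) ` carrier (D (Suc p)) = g p ` B"
    unfolding surj B_def image_image by (rule image_cong) (use comm[of _ "Suc p"] in auto)
  have "vdim (homology D e p) + vdim ((D p)\<lparr>carrier := g p ` B\<rparr>) = vdim ((D p)\<lparr>carrier := g p ` Z\<rparr>)"
    unfolding homology_def ZD BD
    by (rule vdim_quot_subspaces[OF g.W.vectorspace_axioms]) (use BZ in \<open>auto intro: subspace_image[OF g] Z B
      fin_dim_surj_image[OF g surj[symmetric] fin]\<close>)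
  moreover have "vdim (homology C d p) + vdim ((C p)\<lparr>carrier := B\<rparr>) = vdim ((C p)\<lparr>carrier := Z\<rparr>)"
    unfolding Z_def B_def by (rule vdim_homology[OF C fin d dd])
  moreover have "vdim ((D p)\<lparr>carrier := g p ` X\<rparr>) = vdim ((C p)\<lparr>carrier := X\<rparr>)"
    if "VectorSpace.subspace class_ring X (C p)" "X \<subseteq> carrier (C p)" for X
    by (rule dim_image_inj[OF g that(1) inj_on_subset[OF inj that(2)] fin])
  ultimately show ?thesis using Z B BZ ZC by auto
qed

section \<open>Linear extensions of maps on generators\<close>

abbreviation scal :: "'k::field \<Rightarrow> ('a \<Rightarrow>\<^sub>0 'k) \<Rightarrow> ('a \<Rightarrow>\<^sub>0 'k)" where
  "scal a \<equiv> Poly_Mapping.map ((*) a)"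

lemma lookup_scal [simp]: "Poly_Mapping.lookup (scal a c) x = a * Poly_Mapping.lookup c x"
  by (transfer) (auto simp: when_def)

lemma scal_add_right: "scal a (c + d) = scal a c + scal a d"
  by (rule poly_mapping_eqI) (simp add: lookup_add distrib_left)

lemma scal_add_left: "scal (a + b) c = scal a c + scal b c"
  by (rule poly_mapping_eqI) (simp add: lookup_add distrib_right)

lemma scal_scal: "scal a (scal b c) = scal (a * b) c"
  by (rule poly_mapping_eqI) (simp add: mult_ac)

lemma scal_one [simp]: "scal 1 c = c"
  by (rule poly_mapping_eqI) simp

lemma scal_zero_left [simp]: "scal 0 c = 0"
  by (rule poly_mapping_eqI) simp

lemma scal_zero_right [simp]: "scal a 0 = 0"
  by (rule poly_mapping_eqI) simp

lemma scal_minus_one: "scal (- 1) c = - c"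
  by (rule poly_mapping_eqI) simp

lemma keys_scal: "Poly_Mapping.keys (scal a c) \<subseteq> Poly_Mapping.keys c"
  by (auto simp: in_keys_iff)

lemma scal_sum: "scal a (sum f A) = (\<Sum>x\<in>A. scal a (f x))"
  by (induction A rule: infinite_finite_induct) (simp_all add: scal_add_right)

lemma keys_uminus_eq: "Poly_Mapping.keys (- c) = Poly_Mapping.keys (c :: 'a \<Rightarrow>\<^sub>0 'k::field)"
  by (auto simp: in_keys_iff)

text \<open>The linear map on chains with prescribed values on generators. All maps between free modules below
  have this form, so that they can be compared and composed on generators.\<close>
definition lin_ext :: "('a \<Rightarrow> 'b \<Rightarrow>\<^sub>0 'k::field) \<Rightarrow> ('a \<Rightarrow>\<^sub>0 'k) \<Rightarrow> ('b \<Rightarrow>\<^sub>0 'k)" where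
  "lin_ext \<phi> c = (\<Sum>x\<in>Poly_Mapping.keys c. scal (Poly_Mapping.lookup c x) (\<phi> x))"

text \<open>Scaling may shrink the support; summing over a larger set absorbs this.\<close>
lemma lin_ext_superset:
  assumes "finite A" "Poly_Mapping.keys c \<subseteq> A"
  shows "lin_ext \<phi> c = (\<Sum>x\<in>A. scal (Poly_Mapping.lookup c x) (\<phi> x))"
  unfolding lin_ext_def using assms by (intro sum.mono_neutral_left) (auto simp: in_keys_iff)

lemma lin_ext_zero [simp]: "lin_ext \<phi> 0 = 0"
  by (simp add: lin_ext_def)

lemma lin_ext_add: "lin_ext \<phi> (c + d) = lin_ext \<phi> c + lin_ext \<phi> d"
  unfolding lin_ext_def
  by (rule setsum_keys_plus_distrib[where f = "\<lambda>x a. scal a (\<phi> x)"]) (simp_all add: scal_add_left)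

lemma lin_ext_scal: "lin_ext \<phi> (scal a c) = scal a (lin_ext \<phi> c)"
  unfolding lin_ext_superset[OF finite_keys keys_scal]
  by (simp add: lin_ext_def scal_sum scal_scal)

lemma lin_ext_minus: "lin_ext \<phi> (- c) = - lin_ext \<phi> c"
  using lin_ext_scal[of \<phi> "- 1" c] by (simp add: scal_minus_one)

lemma lin_ext_diff: "lin_ext \<phi> (c - d) = lin_ext \<phi> c - lin_ext \<phi> d"
  using lin_ext_add[of \<phi> c "- d"] by (simp add: lin_ext_minus)

lemma lin_ext_sum: "lin_ext \<phi> (sum f A) = (\<Sum>x\<in>A. lin_ext \<phi> (f x))"
  by (induction A rule: infinite_finite_induct) (simp_all add: lin_ext_add)

lemma lin_ext_single [simp]: "lin_ext \<phi> (Poly_Mapping.single x a) = scal a (\<phi> x)"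
  by (simp add: lin_ext_def)

lemma lin_ext_cong:
  "(\<And>x. x \<in> Poly_Mapping.keys c \<Longrightarrow> \<phi> x = \<psi> x) \<Longrightarrow> lin_ext \<phi> c = lin_ext \<psi> c"
  by (simp add: lin_ext_def)

lemma lin_ext_comp: "lin_ext \<psi> (lin_ext \<phi> c) = lin_ext (\<lambda>x. lin_ext \<psi> (\<phi> x)) c"
  by (simp add: lin_ext_def[of \<phi>] lin_ext_def[of "\<lambda>x. lin_ext \<psi> (\<phi> x)"] lin_ext_sum lin_ext_scal)

lemma lin_ext_unit [simp]: "lin_ext (\<lambda>x. Poly_Mapping.single x 1) c = c"
proof (rule poly_mapping_eqI)
  fix y
  have "Poly_Mapping.lookup (lin_ext (\<lambda>x. Poly_Mapping.single x 1) c) y =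
      (\<Sum>x\<in>Poly_Mapping.keys c. if x = y then Poly_Mapping.lookup c x else 0)"
    by (simp add: lin_ext_def lookup_sum lookup_single when_def)
  also have "\<dots> = Poly_Mapping.lookup c y" by (simp add: sum.delta in_keys_iff)
  finally show "Poly_Mapping.lookup (lin_ext (\<lambda>x. Poly_Mapping.single x 1) c) y = Poly_Mapping.lookup c y" .
qed

lemma lin_ext_fun_diff:
  fixes \<phi> \<psi> :: "'a \<Rightarrow> 'b \<Rightarrow>\<^sub>0 'k::field"
  shows "lin_ext (\<lambda>x. \<phi> x - \<psi> x) c = lin_ext \<phi> c - lin_ext \<psi> c"
proof -
  have "scal a (d - e) = scal a d - scal a e" for a :: 'k and d e :: "'b \<Rightarrow>\<^sub>0 'k"
    by (rule poly_mapping_eqI) (simp add: lookup_minus right_diff_distrib)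
  then show ?thesis by (simp add: lin_ext_def sum_subtractf)
qed

lemma keys_diff_subset: "Poly_Mapping.keys (c - d) \<subseteq> Poly_Mapping.keys c \<union> Poly_Mapping.keys (d :: 'a \<Rightarrow>\<^sub>0 'k::field)"
  by (auto simp: in_keys_iff lookup_minus)

lemma keys_empty_iff: "Poly_Mapping.keys c = {} \<longleftrightarrow> c = (0 :: 'a \<Rightarrow>\<^sub>0 'k::field)"
  by (auto intro!: poly_mapping_eqI simp: in_keys_iff set_eq_iff)

section \<open>Free modules and chains\<close>

lemma free_module_simps [simp]:
  "carrier (free_module S) = {c. Poly_Mapping.keys c \<subseteq> S}"
  "zero (free_module S) = 0"
  "add (free_module S) = (+)"
  "Module.smult (free_module S) = scal"
  by (simp_all add: free_module_def)

lemma vectorspace_free_module: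
  "vectorspace (class_ring :: 'k ring) (free_module S :: ('k::field, 'a \<Rightarrow>\<^sub>0 'k) module)"
proof (rule vs_criteria)
  show "field (class_ring :: 'k ring)" by (rule class_field)
  show "\<forall>v w. v \<in> carrier (free_module S) \<and> w \<in> carrier (free_module S) \<longrightarrow>
      v \<oplus>\<^bsub>free_module S\<^esub> w \<in> carrier (free_module S)"
    using keys_add by fastforce
  show "\<forall>v\<in>carrier (free_module S). \<exists>w\<in>carrier (free_module S). v \<oplus>\<^bsub>free_module S\<^esub> w = \<zero>\<^bsub>free_module S\<^esub>"
    by (auto intro!: exI[of _ "- _"] simp: keys_uminus_eq)
  show "\<forall>a v. a \<in> carrier (class_ring :: 'k ring) \<and> v \<in> carrier (free_module S) \<longrightarrow>
      a \<odot>\<^bsub>free_module S\<^esub> v \<in> carrier (free_module S)"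
    using keys_scal by fastforce
qed (auto simp: scal_add_left scal_add_right scal_scal add.assoc add.commute)

lemma free_module_minus:
  assumes "Poly_Mapping.keys c \<subseteq> S" "Poly_Mapping.keys d \<subseteq> S"
  shows "c \<ominus>\<^bsub>free_module S\<^esub> d = c - (d :: 'a \<Rightarrow>\<^sub>0 'k::field)"
proof -
  interpret F: vectorspace "class_ring :: 'k ring" "free_module S :: ('k, 'a \<Rightarrow>\<^sub>0 'k) module"
    by (rule vectorspace_free_module)
  have "\<ominus>\<^bsub>free_module S\<^esub> d = - d"
    by (rule F.minus_equality) (use assms in \<open>auto simp: keys_uminus_eq\<close>)
  then show ?thesis by (simp add: a_minus_def)
qed

lemma linear_map_lin_ext:
  fixes \<phi> :: "'a \<Rightarrow> 'b \<Rightarrow>\<^sub>0 'k::field"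
  assumes "\<And>x. x \<in> S \<Longrightarrow> Poly_Mapping.keys (\<phi> x) \<subseteq> T"
  shows "linear_map (class_ring :: 'k ring) (free_module S) (free_module T) (lin_ext \<phi>)"
proof (rule linear_mapI[OF vectorspace_free_module vectorspace_free_module])
  fix c :: "'a \<Rightarrow>\<^sub>0 'k" assume c: "c \<in> carrier (free_module S)"
  have "Poly_Mapping.keys (lin_ext \<phi> c) \<subseteq> (\<Union>x\<in>Poly_Mapping.keys c. Poly_Mapping.keys (scal (Poly_Mapping.lookup c x) (\<phi> x)))"
    unfolding lin_ext_def by (rule keys_sum)
  also have "\<dots> \<subseteq> T" using c assms keys_scal by fastforce
  finally show "lin_ext \<phi> c \<in> carrier (free_module T)" by simp
qed (simp_all add: lin_ext_add lin_ext_scal)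

text \<open>Used to place a chain in a space of boundaries or of orientation relations one generator at a
  time.\<close>
lemma lin_ext_in_subspace:
  fixes \<phi> :: "'a \<Rightarrow> 'b \<Rightarrow>\<^sub>0 'k::field"
  assumes N: "VectorSpace.subspace (class_ring :: 'k ring) N (free_module T)" and "\<And>x. x \<in> Poly_Mapping.keys c \<Longrightarrow> \<phi> x \<in> N"
  shows "lin_ext \<phi> c \<in> N"
proof -
  have sm: "submodule (class_ring :: 'k ring) N (free_module T)" using N by (simp add: VectorSpace.subspace_def)
  have "(\<Sum>x\<in>A. scal (Poly_Mapping.lookup c x) (\<phi> x)) \<in> N" if "finite A" "A \<subseteq> Poly_Mapping.keys c" for A
    using that
  proof (induction A)
    case empty
    then show ?case using submodule.zero_closed[OF sm] by simp
  next
    case (insert x A)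
    then show ?case
      using submodule.m_closed[OF sm] submodule.smult_closed[OF sm] assms(2) by simp
  qed
  then show ?thesis by (simp add: lin_ext_def)
qed

lemma
  assumes S: "finite S"
  shows fin_dim_free_module: "vectorspace.fin_dim (class_ring :: 'k ring) (free_module S :: ('k::field, 'a \<Rightarrow>\<^sub>0 'k) module)"
    and vdim_free_module: "vdim (free_module S :: ('k, 'a \<Rightarrow>\<^sub>0 'k) module) = card S"
proof -
  interpret F: vectorspace "class_ring :: 'k ring" "free_module S :: ('k, 'a \<Rightarrow>\<^sub>0 'k) module"
    by (rule vectorspace_free_module)
  (* e is the standard basis; injectivity lets coefficients be indexed by S. *)
  define e where "e x = (Poly_Mapping.single x 1 :: 'a \<Rightarrow>\<^sub>0 'k)" for x
  have inj: "inj e" by (auto simp: inj_def e_def dest!: arg_cong[of _ _ Poly_Mapping.keys])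
  have eF: "e ` S \<subseteq> carrier (free_module S)" by (auto simp: e_def)
  have lc: "F.lincomb a (e ` S) = (\<Sum>x\<in>S. Poly_Mapping.single x (a (e x)))" for a
  proof -
    have *: "finsum (free_module S) f A = sum f A" if "f \<in> A \<rightarrow> carrier (free_module S)" "finite A"
      for f :: "('a \<Rightarrow>\<^sub>0 'k) \<Rightarrow> 'a \<Rightarrow>\<^sub>0 'k" and A
      using that(2,1)
    proof (induction A)
      case empty
      then show ?case using F.finsum_empty[of f] by simp
    next
      case (insert x A)
      then have "finsum (free_module S) f (insert x A) = f x \<oplus>\<^bsub>free_module S\<^esub> finsum (free_module S) f A"
        by (intro F.finsum_insert) auto
      with insert show ?case by simp
    qed
    have "F.lincomb a (e ` S) = (\<Sum>v\<in>e ` S. scal (a v) v)"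
    proof -
      have "(\<lambda>v. scal (a v) v) \<in> e ` S \<rightarrow> carrier (free_module S)"
        using eF keys_scal by fastforce
      from *[OF this] S show ?thesis by (simp add: F.lincomb_def)
    qed
    also have "\<dots> = (\<Sum>x\<in>S. scal (a (e x)) (e x))"
      by (simp add: sum.reindex inj_on_subset[OF inj])
    finally show ?thesis by (simp add: e_def)
  qed
  have lk: "Poly_Mapping.lookup (F.lincomb a (e ` S)) y = (if y \<in> S then a (e y) else 0)" for a y
    using S by (simp add: lc lookup_sum lookup_single when_def)
  have li: "F.lin_indpt (e ` S)"
  proof (rule F.finite_lin_indpt2)
    fix a assume "F.lincomb a (e ` S) = \<zero>\<^bsub>free_module S\<^esub>"
    then have "a (e y) = 0" if "y \<in> S" for y using lk[of a y] that by simp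
    then show "\<forall>v\<in>e ` S. a v = \<zero>\<^bsub>class_ring\<^esub>" by simp
  qed (use S eF in auto)
  have gen: "F.gen_set (e ` S)"
  proof (intro equalityI subsetI)
    fix c :: "'a \<Rightarrow>\<^sub>0 'k" assume c: "c \<in> carrier (free_module S)"
    have "c = F.lincomb (\<lambda>v. Poly_Mapping.lookup c (inv_into UNIV e v)) (e ` S)"
      using c by (intro poly_mapping_eqI) (auto simp: lk inv_f_f[OF inj] in_keys_iff)
    then show "c \<in> F.span (e ` S)"
      using S unfolding F.span_def
      by (intro CollectI exI[of _ "e ` S"] exI[of _ "\<lambda>v. Poly_Mapping.lookup c (inv_into UNIV e v)"]) auto
  qed (use F.span_is_subset2[OF eF] in blast)
  show "F.fin_dim" unfolding F.fin_dim_def using S eF gen by blast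
  have "F.dim = card (e ` S)"
    using li gen eF S by (intro F.dim_basis) (auto simp: F.basis_def)
  then show "F.dim = card S" by (simp add: card_image inj_on_subset[OF inj])
qed

lemma boundary_eq_lin_ext:
  "p \<noteq> 0 \<Longrightarrow> boundary p c = lin_ext (\<lambda>x. \<Sum>i\<le>p. Poly_Mapping.single (omit_nth i x) ((-1) ^ i)) c"
  unfolding boundary_def lin_ext_def scal_sum by (simp add: mult.commute)

lemma boundary_add: "boundary p (c + d) = boundary p c + boundary p d"
  by (cases "p = 0") (simp_all add: boundary_eq_lin_ext lin_ext_add, simp add: boundary_def)

lemma boundary_one: "boundary 1 c =
  lin_ext (\<lambda>x. Poly_Mapping.single (omit_nth 0 x) 1 - Poly_Mapping.single (omit_nth 1 x) 1) c"
  by (simp add: boundary_eq_lin_ext single_uminus)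


section \<open>Digraphs whose simplices are vertices and arcs\<close>

text \<open>Since a directed simplex \<open>(x\<^sub>0, x\<^sub>1, x\<^sub>2)\<close> is precisely a transitive triple, the last condition says
  that there are no directed simplices of dimension \<open>2\<close> or more. Asymmetry means that every edge of
  the underlying graph comes from exactly one arc; it also excludes loops.\<close>
locale flat_digraph =
  fixes G :: "'v pair_pre_digraph"
  assumes finite_pverts: "finite (pverts G)"
    and parcs_pverts: "parcs G \<subseteq> pverts G \<times> pverts G"
    and asymmetric: "(u, v) \<in> parcs G \<Longrightarrow> (v, u) \<notin> parcs G"
    and no_transitive_triple: "(u, v) \<in> parcs G \<Longrightarrow> (v, w) \<in> parcs G \<Longrightarrow> (u, w) \<notin> parcs G"
begin

lemma irrefl: "(u, u) \<notin> parcs G"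
  using asymmetric by blast

lemma finite_parcs: "finite (parcs G)"
  using finite_pverts parcs_pverts finite_subset by blast

lemma length_2_cases: "length xs = Suc (Suc 0) \<longleftrightarrow> (\<exists>u v. xs = [u, v])"
  by (auto simp: length_Suc_conv)

lemma directed_simplices_0: "directed_simplices G 0 = (\<lambda>v. [v]) ` pverts G"
  by (auto simp: directed_simplices_def length_Suc_conv)

lemma directed_simplices_1: "directed_simplices G (Suc 0) = (\<lambda>(u, v). [u, v]) ` parcs G"
proof -
  have "[u, v] \<in> directed_simplices G (Suc 0) \<longleftrightarrow> (u, v) \<in> parcs G" for u v
  proof
    assume "[u, v] \<in> directed_simplices G (Suc 0)"
    then have "([u, v] ! 0, [u, v] ! Suc 0) \<in> parcs G"
      unfolding directed_simplices_def by (metis (mono_tags, lifting) lessI mem_Collect_eq)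
    then show "(u, v) \<in> parcs G" by simp
  next
    assume "(u, v) \<in> parcs G"
    then show "[u, v] \<in> directed_simplices G (Suc 0)"
      using parcs_pverts by (auto simp: directed_simplices_def less_Suc_eq)
  qed
  moreover have "\<exists>u v. xs = [u, v]" if "xs \<in> directed_simplices G (Suc 0)" for xs
    using that by (simp add: directed_simplices_def length_2_cases)
  ultimately show ?thesis by fastforce
qed

lemma directed_simplices_ge_2: "2 \<le> p \<Longrightarrow> directed_simplices G p = {}"
proof (rule ccontr)
  assume p: "2 \<le> p" and "directed_simplices G p \<noteq> {}"
  then obtain xs where xs: "length xs = Suc p"
    "\<And>i j. i < j \<Longrightarrow> j < length xs \<Longrightarrow> (xs ! i, xs ! j) \<in> parcs G"
    by (auto simp: directed_simplices_def)
  show False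
    using p xs(1) xs(2)[of 0 1] xs(2)[of 1 2] xs(2)[of 0 2] no_transitive_triple by simp
qed

lemma underlying_complex_iff:
  "s \<in> underlying_complex G \<longleftrightarrow>
    (\<exists>v\<in>pverts G. s = {v}) \<or> (\<exists>u v. (u, v) \<in> parcs G \<and> s = {u, v})"
  by (auto simp: underlying_complex_def undirected_edges_def)

lemma ordered_simplices_0: "ordered_simplices (underlying_complex G) 0 = (\<lambda>v. [v]) ` pverts G"
  using irrefl
  by (auto simp: ordered_simplices_def underlying_complex_iff length_Suc_conv doubleton_eq_iff)

lemma ordered_simplices_1: "ordered_simplices (underlying_complex G) (Suc 0) =
    (\<lambda>(u, v). [u, v]) ` parcs G \<union> (\<lambda>(u, v). [v, u]) ` parcs G"
proof -
  have "[u, v] \<in> ordered_simplices (underlying_complex G) (Suc 0) \<longleftrightarrow> (u, v) \<in> parcs G \<or> (v, u) \<in> parcs G" for u v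
    using irrefl[of u] by (auto simp: ordered_simplices_def underlying_complex_iff doubleton_eq_iff)
  moreover have "\<exists>u v. xs = [u, v]" if "xs \<in> ordered_simplices (underlying_complex G) (Suc 0)" for xs
    using that by (simp add: ordered_simplices_def length_2_cases)
  ultimately show ?thesis by fastforce
qed

lemma ordered_simplices_ge_2:
  assumes "2 \<le> p"
  shows "ordered_simplices (underlying_complex G) p = {}"
proof -
  have "card s \<le> 2" if "s \<in> underlying_complex G" for s
    using that by (auto simp: underlying_complex_iff card_insert_if)
  then show ?thesis using assms by (fastforce simp: ordered_simplices_def distinct_card[symmetric])
qed

lemma directed_subset_ordered:
  "directed_simplices G p \<subseteq> ordered_simplices (underlying_complex G) p"
proof -
  consider "p = 0" | "p = Suc 0" | "2 \<le> p" by linarith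
  then show ?thesis
    by cases (auto simp: directed_simplices_0 directed_simplices_1 directed_simplices_ge_2
      ordered_simplices_0 ordered_simplices_1)
qed

lemma finite_directed_simplices: "finite (directed_simplices G p)"
proof -
  consider "p = 0" | "p = Suc 0" | "2 \<le> p" by linarith
  then show ?thesis
    by cases (auto simp: directed_simplices_0 directed_simplices_1 directed_simplices_ge_2
      finite_pverts finite_parcs)
qed

lemma card_undirected_edges: "card (undirected_edges G) = card (parcs G)"
proof -
  have "undirected_edges G = (\<lambda>(u, v). {u, v}) ` parcs G"
    by (auto simp: undirected_edges_def image_iff)
  moreover have "inj_on (\<lambda>(u, v). {u, v}) (parcs G)"
    using asymmetric by (auto simp: inj_on_def doubleton_eq_iff)
  ultimately show ?thesis by (simp add: card_image)
qed

lemma linear_map_boundary: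
  "linear_map (class_ring :: 'k ring) (free_module (directed_simplices G p))
    (free_module (directed_simplices G (p - 1)) :: ('k::field, 'v list \<Rightarrow>\<^sub>0 'k) module) (boundary p)"
proof -
  consider "p = 0" | "p = 1" | "2 \<le> p" by linarith
  then show ?thesis
  proof cases
    case 1
    then show ?thesis
      by (intro linear_mapI vectorspace_free_module) (auto simp: boundary_def)
  next
    case 2
    have "boundary 1 = (lin_ext (\<lambda>x. Poly_Mapping.single (omit_nth 0 x) 1 - Poly_Mapping.single (omit_nth 1 x) 1)
        :: ('v list \<Rightarrow>\<^sub>0 'k) \<Rightarrow> _)"
      by (rule ext) (rule boundary_one)
    then show ?thesis
      unfolding 2 using parcs_pverts
      by (auto simp: directed_simplices_0 directed_simplices_1 omit_nth_def
        intro!: linear_map_lin_ext order.trans[OF keys_diff_subset])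
  next
    case 3
    then show ?thesis
      by (intro linear_mapI vectorspace_free_module)
        (auto simp: directed_simplices_ge_2 keys_empty_iff boundary_def)
  qed
qed

text \<open>For \<open>p = 0\<close> the outer boundary is zero by convention; for \<open>p > 0\<close> there are no simplices of
  dimension \<open>p + 1\<close>.\<close>
lemma boundary_boundary:
  assumes "c \<in> carrier (free_module (directed_simplices G (Suc p)))"
  shows "boundary p (boundary (Suc p) c) = (0 :: 'v list \<Rightarrow>\<^sub>0 'k::field)"
proof (cases "p = 0")
  case False
  then have "c = 0" using assms by (simp add: directed_simplices_ge_2 keys_empty_iff)
  then show ?thesis by (simp add: boundary_def)
qed (simp add: boundary_def)

text \<open>The map \<open>lin_ext (\<lambda>_. Poly_Mapping.single () 1)\<close> is the augmentation, the sum of the coefficients,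
  with the ground field written as the free module on one point. Walking along a path in either
  direction shows that \<open>[v] - [u]\<close> is a boundary for all \<open>u\<close> and \<open>v\<close>, and a chain with coefficient sum
  \<open>0\<close> is a combination of the differences \<open>[v] - [r]\<close> with a fixed root \<open>r\<close>.\<close>
lemma boundary_image_eq_kernel_augmentation:
  assumes connected: "\<And>u v. u \<in> pverts G \<Longrightarrow> v \<in> pverts G \<Longrightarrow> (u, v) \<in> (parcs G \<union> (parcs G)\<inverse>)\<^sup>*"
    and r: "r \<in> pverts G"
  shows "boundary 1 ` carrier (free_module (directed_simplices G 1)) =
    {c \<in> carrier (free_module (directed_simplices G 0)).
      lin_ext (\<lambda>_. Poly_Mapping.single () 1) c = (0 :: unit \<Rightarrow>\<^sub>0 'k::field)}"
proof -
  define aug where "aug = (lin_ext (\<lambda>_. Poly_Mapping.single () 1) :: ('v list \<Rightarrow>\<^sub>0 'k) \<Rightarrow> unit \<Rightarrow>\<^sub>0 'k)"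
  interpret d: linear_map "class_ring :: 'k ring" "free_module (directed_simplices G 1)"
    "free_module (directed_simplices G 0) :: ('k, 'v list \<Rightarrow>\<^sub>0 'k) module" "boundary 1"
    using linear_map_boundary[of 1] by simp
  define B where "B = (boundary 1 ` carrier (free_module (directed_simplices G 1)) :: ('v list \<Rightarrow>\<^sub>0 'k) set)"
  have B: "VectorSpace.subspace (class_ring :: 'k ring) B (free_module (directed_simplices G 0))"
    using d.imT_is_subspace unfolding B_def d.im_def .
  then have sm: "submodule (class_ring :: 'k ring) B (free_module (directed_simplices G 0))"
    by (simp add: VectorSpace.subspace_def)
  have add: "c + d \<in> B" if "c \<in> B" "d \<in> B" for c d
    using submodule.m_closed[OF sm that] by simp
  have minus: "- c \<in> B" if "c \<in> B" for c
    using submodule.smult_closed[OF sm, of "- 1" c] that by (simp add: scal_minus_one)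
  have arc: "Poly_Mapping.single [v] 1 - Poly_Mapping.single [u] 1 \<in> B" if "(u, v) \<in> parcs G" for u v
    unfolding B_def using that
    by (intro image_eqI[of _ _ "Poly_Mapping.single [u, v] 1"])
      (auto simp: boundary_one[unfolded One_nat_def] directed_simplices_1 omit_nth_def)
  have path: "Poly_Mapping.single [v] 1 - Poly_Mapping.single [u] 1 \<in> B"
    if "(u, v) \<in> (parcs G \<union> (parcs G)\<inverse>)\<^sup>*" for u v
    using that
  proof (induction rule: rtrancl_induct)
    case base
    then show ?case using submodule.zero_closed[OF sm] by simp
  next
    case (step v w)
    then have "Poly_Mapping.single [w] 1 - Poly_Mapping.single [v] 1 \<in> B"
      using arc minus[OF arc] by auto
    from add[OF this step.IH] show ?case by simp
  qed
  have "aug c = 0" if "c \<in> B" for c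
    using that unfolding B_def aug_def by (auto simp: boundary_one[unfolded One_nat_def] lin_ext_comp lin_ext_diff)
      (simp add: lin_ext_def)
  moreover have "c \<in> B" if c: "c \<in> carrier (free_module (directed_simplices G 0))" and "aug c = 0" for c
  proof -
    (* Subtracting the coefficient sum times [r] changes nothing, since that sum is zero. *)
    have "lin_ext (\<lambda>_. Poly_Mapping.single [r] 1) c = lin_ext (\<lambda>_. Poly_Mapping.single [r] 1) (aug c)"
      by (simp add: aug_def lin_ext_comp)
    then have "c = lin_ext (\<lambda>x. Poly_Mapping.single x 1 - Poly_Mapping.single [r] 1) c"
      using \<open>aug c = 0\<close> by (simp add: lin_ext_fun_diff)
    also have "\<dots> \<in> B"
      using c by (intro lin_ext_in_subspace[OF B]) (auto simp: directed_simplices_0 intro!: path connected r)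
    finally show ?thesis .
  qed
  moreover have "B \<subseteq> carrier (free_module (directed_simplices G 0))"
    using sm by (simp add: submodule_def)
  ultimately show ?thesis unfolding aug_def[symmetric] B_def[symmetric] by blast
qed

text \<open>Writing \<open>im q\<close> and \<open>ker q\<close> for the dimensions of the image and the kernel of the \<open>q\<close>-th boundary
  map, everything follows from \<open>dim H\<^sub>q + im (q + 1) = ker q\<close>, from \<open>im q + ker q = dim C\<^sub>q\<close> and from the
  two values \<open>ker 0 = #V\<close> and \<open>im 1 = #V - 1\<close>.\<close>
lemma vdim_dfc_homology:
  assumes connected: "\<And>u v. u \<in> pverts G \<Longrightarrow> v \<in> pverts G \<Longrightarrow> (u, v) \<in> (parcs G \<union> (parcs G)\<inverse>)\<^sup>*"
    and nonempty: "pverts G \<noteq> {}"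
  shows "int (vdim (dfc_homology G p :: ('k::field, ('v list \<Rightarrow>\<^sub>0 'k) set) module)) =
    (if p = 0 then 1
     else if p = 1 then 1 - int (card (pverts G)) + int (card (parcs G))
     else 0)"
proof -
  define C where "C q = (free_module (directed_simplices G q) :: ('k, 'v list \<Rightarrow>\<^sub>0 'k) module)" for q
  define im where "im q = vdim ((C (q - 1))\<lparr>carrier := boundary q ` carrier (C q)\<rparr>)" for q
  define ker where "ker q = vdim ((C q)\<lparr>carrier := {c \<in> carrier (C q). boundary q c = \<zero>\<^bsub>C (q - 1)\<^esub>}\<rparr>)" for q
  have vs: "vectorspace (class_ring :: 'k ring) (C q)" and fd: "vectorspace.fin_dim (class_ring :: 'k ring) (C q)"
    and lin: "linear_map (class_ring :: 'k ring) (C q) (C (q - 1)) (boundary q)" for q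
    unfolding C_def by (rule vectorspace_free_module fin_dim_free_module finite_directed_simplices linear_map_boundary)+
  have hom: "vdim (dfc_homology G q :: ('k, ('v list \<Rightarrow>\<^sub>0 'k) set) module) + im (Suc q) = ker q" for q
  proof -
    have "(dfc_homology G :: nat \<Rightarrow> ('k, ('v list \<Rightarrow>\<^sub>0 'k) set) module) = homology C boundary"
      by (simp add: dfc_homology_def C_def[abs_def])
    moreover have "boundary q (boundary (Suc q) c) = \<zero>\<^bsub>C (q - 1)\<^esub>" if "c \<in> carrier (C (Suc q))" for c
      using that boundary_boundary[of c q] by (simp add: C_def)
    ultimately show ?thesis
      using vdim_homology[of C boundary q, OF vs fd lin] by (simp add: im_def ker_def)
  qed
  have rank: "im q + ker q = card (directed_simplices G q)" for q
    using rank_nullity_vdim[OF lin fd, of q] vdim_free_module[OF finite_directed_simplices[of q], where 'k = 'k]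
    by (simp add: im_def ker_def C_def)
  have card: "card (directed_simplices G q) =
      (if q = 0 then card (pverts G) else if q = 1 then card (parcs G) else 0)" for q
  proof -
    consider "q = 0" | "q = 1" | "2 \<le> q" by linarith
    then show ?thesis
      by cases (auto simp: directed_simplices_0 directed_simplices_1 directed_simplices_ge_2
        intro!: card_image inj_onI)
  qed
  (* In degree 0 the boundary map is zero by convention, so every chain is a cycle. *)
  have ker0: "ker 0 = card (pverts G)"
    using vdim_free_module[OF finite_directed_simplices[of 0], where 'k = 'k] card[of 0]
    by (simp add: ker_def C_def boundary_def free_module_def)
  have im1: "im 1 + 1 = card (pverts G)"
  proof -
    define \<epsilon> where "\<epsilon> = (lin_ext (\<lambda>_. Poly_Mapping.single () 1) :: ('v list \<Rightarrow>\<^sub>0 'k) \<Rightarrow> unit \<Rightarrow>\<^sub>0 'k)"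
    obtain r where r: "r \<in> pverts G" using nonempty by blast
    have lin\<epsilon>: "linear_map (class_ring :: 'k ring) (C 0) (free_module {()}) \<epsilon>"
      unfolding \<epsilon>_def C_def by (rule linear_map_lin_ext) simp
    have "c \<in> \<epsilon> ` carrier (C 0)" for c :: "unit \<Rightarrow>\<^sub>0 'k"
    proof (rule image_eqI)
      show "Poly_Mapping.single [r] (Poly_Mapping.lookup c ()) \<in> carrier (C 0)"
        using r by (simp add: C_def directed_simplices_0)
      show "c = \<epsilon> (Poly_Mapping.single [r] (Poly_Mapping.lookup c ()))"
        by (rule poly_mapping_eqI) (simp add: \<epsilon>_def lookup_single)
    qed
    then have surj: "\<epsilon> ` carrier (C 0) = carrier (free_module {()})" by auto
    have "vdim (free_module {()} :: ('k, unit \<Rightarrow>\<^sub>0 'k) module) +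
        vdim ((C 0)\<lparr>carrier := {c \<in> carrier (C 0). \<epsilon> c = 0}\<rparr>) = vdim (C 0)"
      using rank_nullity_surj[OF lin\<epsilon> surj fd] by simp
    also have "{c \<in> carrier (C 0). \<epsilon> c = 0} = boundary 1 ` carrier (C 1)"
      using boundary_image_eq_kernel_augmentation[OF connected r, where 'k = 'k]
      unfolding C_def \<epsilon>_def by simp
    finally show ?thesis
      using vdim_free_module[OF finite_directed_simplices[of 0], where 'k = 'k] card[of 0]
        vdim_free_module[of "{()}", where 'k = 'k]
      by (simp add: im_def C_def)
  qed
  consider "p = 0" | "p = 1" | "2 \<le> p" by linarith
  then show ?thesis
  proof cases
    case 1
    then show ?thesis using hom[of 0] ker0 im1 by simp
  next
    case 2
    then show ?thesis using hom[of 1] rank[of 1] rank[of 2] card[of 1] card[of 2] im1 by (simp add: numeral_2_eq_2)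
  next
    case 3
    then show ?thesis using hom[of p] rank[of p] card[of p] by simp
  qed
qed


section \<open>Oriented chains of the underlying graph\<close>

text \<open>An ordered simplex that is not directed is an edge traversed against its arc. The dimension is
  read off from the length of the list, so that one formula serves all degrees.\<close>
definition straighten_simplex :: "'v list \<Rightarrow> ('v list \<Rightarrow>\<^sub>0 'k::field)" where
  "straighten_simplex x = (if x \<in> directed_simplices G (length x - 1)
     then Poly_Mapping.single x 1 else Poly_Mapping.single (rev x) (- 1))"

definition straighten :: "('v list \<Rightarrow>\<^sub>0 'k::field) \<Rightarrow> ('v list \<Rightarrow>\<^sub>0 'k)" where
  "straighten = lin_ext straighten_simplex"

definition orientation_generators :: "nat \<Rightarrow> ('v list \<Rightarrow>\<^sub>0 'k::field) set" where
  "orientation_generators p =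
    {Poly_Mapping.single (permute_list \<sigma> x) 1 - Poly_Mapping.single x (of_int (sign \<sigma>)) | \<sigma> x.
      \<sigma> permutes {..<length x} \<and> x \<in> ordered_simplices (underlying_complex G) p}"

abbreviation ordered_chains :: "nat \<Rightarrow> ('k::field, 'v list \<Rightarrow>\<^sub>0 'k) module" where
  "ordered_chains p \<equiv> free_module (ordered_simplices (underlying_complex G) p)"

abbreviation relations :: "nat \<Rightarrow> ('v list \<Rightarrow>\<^sub>0 'k::field) set" where
  "relations p \<equiv> orientation_relations (underlying_complex G) p"

lemma relations_eq_span:
  "relations p = LinearCombinations.module.span (class_ring :: 'k ring)
    (ordered_chains p :: ('k::field, 'v list \<Rightarrow>\<^sub>0 'k) module) (orientation_generators p)"
  by (simp add: orientation_relations_def orientation_generators_def)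

text \<open>A vertex has only the trivial reordering, and an edge has besides it the transposition, whose sign
  is \<open>-1\<close>; so the only relations that matter are \<open>[v, u] = -[u, v]\<close>.\<close>
lemma orientation_generator_cases:
  assumes "g \<in> (orientation_generators p :: ('v list \<Rightarrow>\<^sub>0 'k::field) set)"
  obtains "g = 0"
  | u v where "p = 1" "(u, v) \<in> parcs G" "g = Poly_Mapping.single [u, v] 1 + Poly_Mapping.single [v, u] 1"
proof -
  obtain \<sigma> x where \<sigma>: "\<sigma> permutes {..<length x}" and x: "x \<in> ordered_simplices (underlying_complex G) p"
    and g: "g = Poly_Mapping.single (permute_list \<sigma> x) 1 - Poly_Mapping.single x (of_int (sign \<sigma>))"
    using assms by (auto simp: orientation_generators_def)
  have id0: "g = 0" if "\<sigma> = id"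
    using that by (simp add: g)
  consider "p = 0" | "p = 1" | "2 \<le> p" by linarith
  then show thesis
  proof cases
    case 1
    then have "\<sigma> permutes {0}" using x \<sigma> by (auto simp: ordered_simplices_0 lessThan_Suc)
    then show thesis using id0 that(1) by (simp add: permutes_sing)
  next
    case 2
    then obtain u v where x_uv: "x = [u, v]" and uv: "(u, v) \<in> parcs G \<or> (v, u) \<in> parcs G"
      using x by (auto simp: ordered_simplices_1)
    have "\<sigma> permutes {0, 1}"
      using \<sigma> by (simp add: x_uv numeral_2_eq_2 lessThan_Suc insert_commute)
    then consider "\<sigma> = id" | "\<sigma> = Transposition.transpose 0 1" by (auto simp: permutes_doubleton_iff)
    then show thesis
    proof cases
      case 1
      then show thesis using id0 that(1) by simp
    next
      case 2
      have "permute_list \<sigma> x = [v, u]"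
        by (simp add: 2 x_uv permute_list_def upt_rec)
      moreover have "sign \<sigma> = - 1" by (simp add: 2 sign_swap_id)
      ultimately have "g = Poly_Mapping.single [v, u] 1 + Poly_Mapping.single [u, v] 1"
        by (simp add: g x_uv single_uminus)
      then show thesis using that(2) uv \<open>p = 1\<close> by (metis add.commute)
    qed
  next
    case 3
    then show thesis using x by (simp add: ordered_simplices_ge_2)
  qed
qed

lemma reversal_relation:
  assumes "(u, v) \<in> parcs G"
  shows "Poly_Mapping.single [u, v] 1 + Poly_Mapping.single [v, u] 1 \<in>
    (orientation_generators 1 :: ('v list \<Rightarrow>\<^sub>0 'k::field) set)"
  unfolding orientation_generators_def
proof (intro CollectI exI conjI)
  let ?\<sigma> = "Transposition.transpose 0 (1 :: nat)"
  show "?\<sigma> permutes {..<length [v, u]}"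
    by (rule permutes_swap_id) auto
  show "[v, u] \<in> ordered_simplices (underlying_complex G) 1"
    using assms by (auto simp: ordered_simplices_1)
  show "Poly_Mapping.single [u, v] 1 + Poly_Mapping.single [v, u] 1 =
      Poly_Mapping.single (permute_list ?\<sigma> [v, u]) 1 - Poly_Mapping.single [v, u] (of_int (sign ?\<sigma>) :: 'k)"
    by (simp add: permute_list_def upt_rec sign_swap_id single_uminus)
qed

lemma orientation_generators_subset: "orientation_generators p \<subseteq> carrier (ordered_chains p)"
proof
  fix g :: "'v list \<Rightarrow>\<^sub>0 'k::field" assume "g \<in> orientation_generators p"
  then show "g \<in> carrier (ordered_chains p)"
  proof (cases rule: orientation_generator_cases)
    case (2 u v)
    then show ?thesis
      by (auto simp: ordered_simplices_1 intro!: order.trans[OF keys_add])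
  qed simp
qed

lemma relations_subspace:
  "VectorSpace.subspace (class_ring :: 'k ring) (relations p) (ordered_chains p :: ('k::field, 'v list \<Rightarrow>\<^sub>0 'k) module)"
  unfolding relations_eq_span
  by (rule vectorspace.span_is_subspace[OF vectorspace_free_module orientation_generators_subset])

text \<open>The kernel of a linear map is a subspace, so it contains the span of the relations as soon as it
  contains the generators.\<close>
lemma lin_ext_vanishes_on_relations:
  fixes \<phi> :: "'v list \<Rightarrow> 'b \<Rightarrow>\<^sub>0 'k::field"
  assumes gen: "\<And>u v. p = 1 \<Longrightarrow> (u, v) \<in> parcs G \<Longrightarrow> \<phi> [u, v] + \<phi> [v, u] = 0"
    and r: "r \<in> relations p"
  shows "lin_ext \<phi> r = 0"
proof -
  interpret lin: linear_map "class_ring :: 'k ring" "ordered_chains p :: ('k, 'v list \<Rightarrow>\<^sub>0 'k) module"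
    "free_module UNIV" "lin_ext \<phi>"
    by (rule linear_map_lin_ext) simp
  have "orientation_generators p \<subseteq> lin.ker"
  proof
    fix g :: "'v list \<Rightarrow>\<^sub>0 'k" assume g: "g \<in> orientation_generators p"
    then have "lin_ext \<phi> g = 0"
      by (cases rule: orientation_generator_cases) (simp_all add: lin_ext_add gen)
    then show "g \<in> lin.ker" using g orientation_generators_subset by (auto simp: lin.ker_def)
  qed
  then have "relations p \<subseteq> lin.ker"
    unfolding relations_eq_span
    using lin.kerT_is_subspace unfolding VectorSpace.subspace_def
    by (intro LinearCombinations.module.span_is_subset) (auto simp: vectorspace_def)
  with r show ?thesis by (auto simp: lin.ker_def)
qed

text \<open>In degree \<open>1\<close>, \<open>\<partial>[u, v] + \<partial>[v, u] = 0\<close>. Thus the boundary is constant on oriented classes, even as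
  an ordered chain.\<close>
lemma boundary_vanishes_on_relations:
  assumes "r \<in> relations p"
  shows "boundary p r = (0 :: 'v list \<Rightarrow>\<^sub>0 'k::field)"
proof -
  consider "p = 0" | "p = 1" | "2 \<le> p" by linarith
  then show ?thesis
  proof cases
    case 2
    show ?thesis
      unfolding 2 boundary_one using assms 2
      by (intro lin_ext_vanishes_on_relations[of 1]) (simp_all add: omit_nth_def)
  next
    case 3
    have "r \<in> carrier (ordered_chains p)"
      using assms relations_subspace[of p, where 'k = 'k] by (auto simp: VectorSpace.subspace_def submodule_def)
    with 3 show ?thesis by (simp add: ordered_simplices_ge_2 keys_empty_iff boundary_def)
  qed (simp add: boundary_def)
qed

lemma straighten_relations: "r \<in> relations p \<Longrightarrow> straighten r = 0"
  unfolding straighten_def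
  by (rule lin_ext_vanishes_on_relations)
    (use asymmetric in \<open>auto simp: straighten_simplex_def directed_simplices_1 single_uminus\<close>)

lemma straighten_directed:
  assumes "c \<in> carrier (free_module (directed_simplices G p))"
  shows "straighten c = c"
proof -
  have "x \<in> directed_simplices G (length x - 1)" if "x \<in> Poly_Mapping.keys c" for x
    using assms that by (auto simp: directed_simplices_def)
  then have "straighten c = lin_ext (\<lambda>x. Poly_Mapping.single x 1) c"
    unfolding straighten_def by (intro lin_ext_cong) (simp add: straighten_simplex_def)
  then show ?thesis by simp
qed

lemma ordered_simplex_cases:
  assumes "x \<in> ordered_simplices (underlying_complex G) p"
  obtains "x \<in> directed_simplices G p" "length x = Suc p"
  | u v where "p = 1" "(u, v) \<in> parcs G" "x = [v, u]"
proof -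
  consider "p = 0" | "p = 1" | "2 \<le> p" by linarith
  then show thesis
  proof cases
    case 1
    then show thesis using assms that(1) by (auto simp: ordered_simplices_0 directed_simplices_0)
  next
    case 2
    then obtain u v where "(u, v) \<in> parcs G" "x = [u, v] \<or> x = [v, u]"
      using assms by (auto simp: ordered_simplices_1)
    moreover from this have "[u, v] \<in> directed_simplices G p" using 2 by (force simp: directed_simplices_1)
    ultimately show thesis using 2 that by auto
  next
    case 3
    then show thesis using assms by (simp add: ordered_simplices_ge_2)
  qed
qed

lemma straighten_closed:
  fixes c :: "'v list \<Rightarrow>\<^sub>0 'k::field"
  assumes "c \<in> carrier (ordered_chains p)"
  shows "straighten c \<in> carrier (free_module (directed_simplices G p))"
proof -
  have "Poly_Mapping.keys (straighten_simplex x :: 'v list \<Rightarrow>\<^sub>0 'k) \<subseteq> directed_simplices G p" if "x \<in> ordered_simplices (underlying_complex G) p" for x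
    using that asymmetric by (cases rule: ordered_simplex_cases) (auto simp: straighten_simplex_def directed_simplices_1)
  from linear_map_lin_ext[OF this]
  interpret linear_map "class_ring :: 'k ring" "ordered_chains p" "free_module (directed_simplices G p)" "straighten"
    by (simp add: straighten_def)
  show ?thesis using f_im[OF assms] .
qed

text \<open>Straightening does not change the oriented class, which makes every class the class of a directed
  chain.\<close>
lemma diff_straighten_in_relations:
  fixes c :: "'v list \<Rightarrow>\<^sub>0 'k::field"
  assumes "c \<in> carrier (ordered_chains p)"
  shows "c - straighten c \<in> relations p"
proof -
  have "c - straighten c = lin_ext (\<lambda>x. Poly_Mapping.single x 1 - straighten_simplex x) c"
    by (simp add: lin_ext_fun_diff straighten_def)
  also have "\<dots> \<in> relations p"
  proof (rule lin_ext_in_subspace[OF relations_subspace])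
    fix x assume "x \<in> Poly_Mapping.keys c"
    then have x: "x \<in> ordered_simplices (underlying_complex G) p" using assms by auto
    then show "Poly_Mapping.single x 1 - straighten_simplex x \<in> (relations p :: ('v list \<Rightarrow>\<^sub>0 'k) set)"
    proof (cases rule: ordered_simplex_cases)
      case 1
      then show ?thesis
        using relations_subspace[of p, where 'k = 'k]
        by (simp add: straighten_simplex_def VectorSpace.subspace_def submodule_def)
    next
      case (2 u v)
      have "Poly_Mapping.single x 1 - straighten_simplex x = Poly_Mapping.single [u, v] 1 + Poly_Mapping.single [v, u] 1"
        using 2 asymmetric by (auto simp: straighten_simplex_def directed_simplices_1 single_uminus)
      also have "\<dots> \<in> orientation_generators p" using reversal_relation[OF 2(2)] 2(1) by simp
      also have "orientation_generators p \<subseteq> relations p"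
        unfolding relations_eq_span
        by (rule LinearCombinations.module.in_own_span[OF _ orientation_generators_subset])
          (use vectorspace_free_module vectorspace_def in blast)
      finally show ?thesis .
    qed
  qed
  finally show ?thesis .
qed

text \<open>The chain isomorphism is \<open>g q c = relations q + c\<close>. If directed chains \<open>c\<close> and \<open>c'\<close> have the same
  class, straightening kills \<open>c - c'\<close>, but it also fixes it; hence \<open>g q\<close> is injective.\<close>
theorem vdim_simplicial_homology_eq_dfc:
  "vdim (simplicial_homology (underlying_complex G) p :: ('k::field, ('v list \<Rightarrow>\<^sub>0 'k) set set) module) =
    vdim (dfc_homology G p :: ('k, ('v list \<Rightarrow>\<^sub>0 'k) set) module)"
proof -
  define C where "C q = (free_module (directed_simplices G q) :: ('k, 'v list \<Rightarrow>\<^sub>0 'k) module)" for q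
  define D where "D q = (oriented_chains (underlying_complex G) q :: ('k, ('v list \<Rightarrow>\<^sub>0 'k) set) module)" for q
  define g where "g q c = (relations q :: ('v list \<Rightarrow>\<^sub>0 'k) set) +>\<^bsub>ordered_chains q\<^esub> c" for q c
  have D: "D q = quot_module (ordered_chains q) (relations q)" for q
    by (simp add: D_def oriented_chains_def)
  have sub: "carrier (C q) \<subseteq> carrier (ordered_chains q)" for q
    using directed_subset_ordered[of q] by (auto simp: C_def)
  have vsD: "vectorspace (class_ring :: 'k ring) (D q)" for q
    unfolding D by (rule vectorspace_quot_module[OF vectorspace_free_module relations_subspace])
  have ling: "linear_map (class_ring :: 'k ring) (ordered_chains q) (D q) (g q)" for q
    unfolding D g_def[abs_def] by (rule linear_map_coset[OF vectorspace_free_module relations_subspace])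
  have surj: "g q ` carrier (ordered_chains q) = carrier (D q)" for q
    unfolding D g_def[abs_def] by (rule coset_surj[OF vectorspace_free_module relations_subspace])
  have eq_iff: "g q c = g q c' \<longleftrightarrow> c - c' \<in> relations q"
    if "c \<in> carrier (ordered_chains q)" "c' \<in> carrier (ordered_chains q)" for q c c'
    using coset_eq_iff[OF vectorspace_free_module relations_subspace that] that
    by (simp add: g_def free_module_minus)
  have "vdim (homology D (oriented_boundary (underlying_complex G)) p) = vdim (homology C boundary p)"
  proof (rule vdim_homology_chain_iso[where g = g])
    fix q
    show vsC: "vectorspace (class_ring :: 'k ring) (C q)"
      and "vectorspace.fin_dim (class_ring :: 'k ring) (C q)"
      and "linear_map (class_ring :: 'k ring) (C q) (C (q - 1)) (boundary q)"
      unfolding C_def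
      by (rule vectorspace_free_module fin_dim_free_module finite_directed_simplices linear_map_boundary)+
    interpret g: linear_map "class_ring :: 'k ring" "ordered_chains q" "D q" "g q" by (rule ling)
    show "linear_map (class_ring :: 'k ring) (C q) (D q) (g q)"
    proof (rule linear_mapI[OF vsC vsD])
      fix c c' a assume c: "c \<in> carrier (C q)"
      then have cO: "c \<in> carrier (ordered_chains q)" using sub by blast
      show "g q c \<in> carrier (D q)" using g.f_im[OF cO] .
      show "g q (a \<odot>\<^bsub>C q\<^esub> c) = a \<odot>\<^bsub>D q\<^esub> g q c" using g.f_smult[OF _ cO, of a] by (simp add: C_def)
      assume "c' \<in> carrier (C q)"
      then have "c' \<in> carrier (ordered_chains q)" using sub by blast
      from g.f_add[OF cO this] show "g q (c \<oplus>\<^bsub>C q\<^esub> c') = g q c \<oplus>\<^bsub>D q\<^esub> g q c'" by (simp add: C_def)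
    qed
    show "bij_betw (g q) (carrier (C q)) (carrier (D q))"
      unfolding bij_betw_def
    proof
      show "inj_on (g q) (carrier (C q))"
      proof (rule inj_onI)
        fix c c' assume c: "c \<in> carrier (C q)" "c' \<in> carrier (C q)" and "g q c = g q c'"
        then have "straighten (c - c') = 0"
          using sub[of q] eq_iff by (intro straighten_relations[of _ q]) blast
        then show "c = c'"
          using c straighten_directed[of c q] straighten_directed[of c' q]
          by (simp add: straighten_def lin_ext_diff C_def)
      qed
      have "g q c \<in> g q ` carrier (C q)" if c: "c \<in> carrier (ordered_chains q)" for c
      proof (rule image_eqI)
        show "straighten c \<in> carrier (C q)" using straighten_closed[OF c] by (simp add: C_def)
        then show "g q c = g q (straighten c)"
          using eq_iff[OF c] sub diff_straighten_in_relations[OF c] by blast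
      qed
      then show "g q ` carrier (C q) = carrier (D q)"
        using sub[of q] unfolding surj[symmetric] by blast
    qed
    fix c assume c: "c \<in> carrier (C q)"
    (* The induced boundary is a union over the class of c; all its members give the same value. *)
    have "boundary q c' = boundary q c" if c': "c' \<in> g q c" for c'
    proof -
      obtain r where "r \<in> relations q" "c' = r + c"
        using c' by (auto simp: g_def a_r_coset_def')
      then show ?thesis by (simp add: boundary_add boundary_vanishes_on_relations)
    qed
    then have "(\<Union>c'\<in>g q c. g (q - 1) (boundary q c')) = (\<Union>c'\<in>g q c. g (q - 1) (boundary q c))"
      by (intro SUP_cong refl) simp
    moreover have "0 + c \<in> g q c"
      using relations_subspace[of q, where 'k = 'k]
      by (auto simp: g_def a_r_coset_def' VectorSpace.subspace_def submodule_def)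
    ultimately show "oriented_boundary (underlying_complex G) q (g q c) = g (q - 1) (boundary q c)"
      unfolding oriented_boundary_def g_def[of "q - 1", symmetric] by auto
  next
    fix c assume "c \<in> carrier (C (Suc p))"
    then show "boundary p (boundary (Suc p) c) = \<zero>\<^bsub>C (p - 1)\<^esub>"
      using boundary_boundary[of c p] by (simp add: C_def)
  qed
  then show ?thesis
    by (simp add: simplicial_homology_def dfc_homology_def C_def[abs_def] D_def[abs_def])
qed

end

section \<open>Feedforward networks\<close>

text \<open>An arc raises the layer index by one. A reversed arc would lower it, and the closing arc of a
  transitive triple would raise it by two.\<close>
lemma flat_digraph_mlp:
  assumes layers: "mlp_layers L n K"
  shows "flat_digraph (mlp_digraph L K)"
proof -
  have disj: "i = j" if "v \<in> K i" "v \<in> K j" "i \<in> {1..L}" "j \<in> {1..L}" for i j v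
    using layers that unfolding mlp_layers_def disjoint_family_on_def by blast
  have arc: "(u, v) \<in> parcs (mlp_digraph L K) \<longleftrightarrow> (\<exists>i. 1 \<le> i \<and> i < L \<and> u \<in> K i \<and> v \<in> K (Suc i))" for u v
  proof -
    have "i \<in> {1..L - 1} \<longleftrightarrow> 1 \<le> i \<and> i < L" for i by auto
    then show ?thesis by (simp add: mlp_digraph_def del: atLeastAtMost_iff) blast
  qed
  show ?thesis
  proof
    show "finite (pverts (mlp_digraph L K))"
      using layers by (auto simp: mlp_digraph_def mlp_layers_def)
    show "parcs (mlp_digraph L K) \<subseteq> pverts (mlp_digraph L K) \<times> pverts (mlp_digraph L K)"
      by (fastforce simp: mlp_digraph_def)
    fix u v w assume uv: "(u, v) \<in> parcs (mlp_digraph L K)"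
    then obtain i where i: "1 \<le> i" "i < L" "u \<in> K i" "v \<in> K (Suc i)" unfolding arc by blast
    show "(v, u) \<notin> parcs (mlp_digraph L K)"
    proof
      assume "(v, u) \<in> parcs (mlp_digraph L K)"
      then obtain j where "1 \<le> j" "j < L" "v \<in> K j" "u \<in> K (Suc j)" unfolding arc by blast
      then show False using i disj[of v "Suc i" j] disj[of u i "Suc j"] by simp
    qed
    assume "(v, w) \<in> parcs (mlp_digraph L K)"
    then obtain j where j: "1 \<le> j" "j < L" "v \<in> K j" "w \<in> K (Suc j)" unfolding arc by blast
    show "(u, w) \<notin> parcs (mlp_digraph L K)"
    proof
      assume "(u, w) \<in> parcs (mlp_digraph L K)"
      then obtain k where "1 \<le> k" "k < L" "u \<in> K k" "w \<in> K (Suc k)" unfolding arc by blast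
      then show False using i j disj[of v "Suc i" j] disj[of u i k] disj[of w "Suc j" "Suc k"] by simp
    qed
  qed
qed

text \<open>Every vertex is joined to a root \<open>r\<close> in the first layer. For another vertex of that layer the path
  makes a detour through the second layer, and this is where \<open>L \<ge> 2\<close> is needed; later layers follow
  by induction.\<close>
lemma mlp_connected:
  assumes L: "2 \<le> L" and nonempty: "\<And>i. i \<in> {1..L} \<Longrightarrow> K i \<noteq> {}"
    and "u \<in> pverts (mlp_digraph L K)" "v \<in> pverts (mlp_digraph L K)"
  shows "(u, v) \<in> (parcs (mlp_digraph L K) \<union> (parcs (mlp_digraph L K))\<inverse>)\<^sup>*"
proof -
  define R where "R = parcs (mlp_digraph L K) \<union> (parcs (mlp_digraph L K))\<inverse>"
  have sym: "(x, y) \<in> R\<^sup>* \<longleftrightarrow> (y, x) \<in> R\<^sup>*" for x y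
    using sym_rtrancl[of R] by (auto simp: R_def sym_def)
  have forward: "(x, y) \<in> R" if "1 \<le> i" "i < L" "x \<in> K i" "y \<in> K (Suc i)" for i x y
    using that by (auto simp: R_def mlp_digraph_def)
  obtain r where r: "r \<in> K 1" using nonempty[of 1] L by auto
  have root: "(r, w) \<in> R\<^sup>*" if "1 \<le> i" "i \<le> L" "w \<in> K i" for i w
    using that
  proof (induction i arbitrary: w rule: dec_induct)
    case base
    obtain x where x: "x \<in> K (Suc 1)" using nonempty[of 2] L by (auto simp: numeral_2_eq_2)
    have "(r, x) \<in> R" "(w, x) \<in> R" using forward[of 1] r x base L by auto
    then show ?case using sym by (meson r_into_rtrancl rtrancl_trans)
  next
    case (step i)
    obtain x where x: "x \<in> K i" using nonempty[of i] step by auto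
    have "(r, x) \<in> R\<^sup>*" using step.IH[OF _ x] step.prems by simp
    moreover have "(x, w) \<in> R"
      using \<open>1 \<le> i\<close> step.prems x by (intro forward[of i]) auto
    ultimately show ?case by (rule rtrancl_into_rtrancl)
  qed
  have "(r, u) \<in> R\<^sup>*" "(r, v) \<in> R\<^sup>*" using assms(3,4) root by (auto simp: mlp_digraph_def)
  then show ?thesis using sym unfolding R_def by (meson rtrancl_trans)
qed

theorem theorem2:
  fixes L :: nat and n :: "nat \<Rightarrow> nat" and K :: "nat \<Rightarrow> 'v set"
    and G :: "'v pair_pre_digraph" and p :: nat
  assumes "L \<ge> 2"
    and "\<And>i. i \<in> {1..L} \<Longrightarrow> n i \<ge> 1"
    and "mlp_layers L n K"
    and "G = mlp_digraph L K"
  shows "vdim (dfc_homology G p :: ('k::field, ('v list \<Rightarrow>\<^sub>0 'k) set) module) =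
      vdim (simplicial_homology (underlying_complex G) p
        :: ('k, ('v list \<Rightarrow>\<^sub>0 'k) set set) module) \<and>
    int (vdim (dfc_homology G p :: ('k, ('v list \<Rightarrow>\<^sub>0 'k) set) module)) =
      (if p = 0 then 1
       else if p = 1 then 1 - int (card (pverts G)) + int (card (undirected_edges G))
       else 0)"
proof -
  interpret flat_digraph G unfolding assms(4) by (rule flat_digraph_mlp[OF assms(3)])
  have nonempty: "K i \<noteq> {}" if "i \<in> {1..L}" for i
    using assms(2)[OF that] assms(3) that unfolding mlp_layers_def by (metis card.empty not_one_le_zero)
  have "pverts G \<noteq> {}" using nonempty[of 1] assms(1,4) by (auto simp: mlp_digraph_def)
  moreover have "(u, v) \<in> (parcs G \<union> (parcs G)\<inverse>)\<^sup>*" if "u \<in> pverts G" "v \<in> pverts G" for u v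
    using mlp_connected[of L K u v] assms(1) nonempty that unfolding assms(4) by blast
  ultimately show ?thesis
    using vdim_dfc_homology[of p, where 'k = 'k] vdim_simplicial_homology_eq_dfc[of p, where 'k = 'k]
    by (simp add: card_undirected_edges)
qed

end
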